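(* Let $n\ge 5$ and let $K\subset\mathbb{R}^n$ be an origin-symmetric convex body that is a direct sum of a segment and an $(n-1)$-dimensional body. Then $K$ is not an intersection body.
   Context: A convex body in $\mathbb{R}^n$ is a compact convex set with nonempty interior. $K$ is a direct sum of a segment $A$ and an $(n-1)$-dimensional body $B$ if $K=A+B=\{a+b:a\in A,b\in B\}$ with $A$ a segment and $B$ a compact convex set such that $\dim\mathrm{span}(A)=1$, $\dim\mathrm{span}(B)=n-1$ and $\mathbb{R}^n=\mathrm{span}(A)\oplus\mathrm{span}(B)$. Because the sum is direct, $A$ and $B$ inherit origin symmetry from $K$. For a star body $K$ with the origin in its interior, the radial function is $\rho_K(\xi)=\max\{a: a\xi\in K\}$, $\xi\in S^{n-1}$. The spherical Radon transform of a continuous function $g$ on $S^{n-1}$ is $Rg(\xi)=\int_{S^{n-1}\cap\xi^\perp} g(\theta)\,d\theta$. An origin-symmetric star body $K\subset\mathbb{R}^n$ is an intersection body if $\rho_K$ is the spherical Radon transform of an even non-negative finite Borel measure $\mu$ on $S^{n-1}$, i.e. $\int_{S^{n-1}}\rho_K(\xi)g(\xi)\,d\xi=\int_{S^{n-1}}Rg(\xi)\,d\mu(\xi)$ for every continuous function $g$ on $S^{n-1}$. *)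

theory Defs
  imports "HOL-Analysis.Analysis"
begin

definition convex_body :: "'a::euclidean_space set \<Rightarrow> bool" where
  "convex_body K \<longleftrightarrow> compact K \<and> convex K \<and> interior K \<noteq> {}"

definition origin_symmetric :: "'a::real_vector set \<Rightarrow> bool" where
  "origin_symmetric K \<longleftrightarrow> uminus ` K = K"

definition segment_body_direct_sum :: "'a::euclidean_space set \<Rightarrow> 'a set \<Rightarrow> 'a set \<Rightarrow> bool" where
  "segment_body_direct_sum K A B \<longleftrightarrow>
     K = {a + b |a b. a \<in> A \<and> b \<in> B} \<and>
     (\<exists>p q. A = closed_segment p q) \<and> compact B \<and> convex B \<and>
     dim (span A) = 1 \<and> dim (span B) = DIM('a) - 1 \<and>
     {u + v |u v. u \<in> span A \<and> v \<in> span B} = UNIV \<and> span A \<inter> span B = {0}"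

definition radial :: "'a::real_vector set \<Rightarrow> 'a \<Rightarrow> real" where
  "radial K \<xi> = (GREATEST a. a *\<^sub>R \<xi> \<in> K)"

definition star_body :: "'a::euclidean_space set \<Rightarrow> bool" where
  "star_body K \<longleftrightarrow> compact K \<and> 0 \<in> interior K \<and>
     (\<forall>x\<in>K. \<forall>t\<in>{0..1}. t *\<^sub>R x \<in> K) \<and> continuous_on (sphere 0 1) (radial K)"

text \<open>
  Lebesgue measure on a linear subspace, in the coordinates of an orthonormal basis.
  The choice of basis is immaterial because Lebesgue measure is invariant under
  orthogonal maps.
\<close>

definition orthonormal_basis_of :: "'a::euclidean_space set \<Rightarrow> 'a set \<Rightarrow> bool" where
  "orthonormal_basis_of V B \<longleftrightarrow>
     B \<subseteq> V \<and> pairwise orthogonal B \<and> (\<forall>b\<in>B. norm b = 1) \<and> span B = V"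

definition some_onb :: "'a::euclidean_space set \<Rightarrow> 'a set" where
  "some_onb V = (SOME B. orthonormal_basis_of V B)"

definition subspace_lborel :: "'a::euclidean_space set \<Rightarrow> 'a measure" where
  "subspace_lborel V =
     distr (\<Pi>\<^sub>M b\<in>some_onb V. lborel) borel (\<lambda>f. \<Sum>b\<in>some_onb V. f b *\<^sub>R b)"

text \<open>
  Unnormalised surface measure on the unit sphere of a subspace \<open>V\<close>, given by polar
  coordinates: a Borel set \<open>E\<close> of unit vectors of \<open>V\<close> has measure \<open>dim V\<close> times the
  Lebesgue measure in \<open>V\<close> of the cone \<open>{r x | x \<in> E, 0 < r \<le> 1}\<close>. Note that \<open>sgn x\<close> is
  \<open>x /\<^sub>R norm x\<close>. The measure space is the sphere itself, so integrands need only be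
  measurable there.
\<close>

definition sphere_measure :: "'a::euclidean_space set \<Rightarrow> 'a measure" where
  "sphere_measure V = scale_measure (of_nat (dim V))
     (distr (restrict_space (subspace_lborel V) (V \<inter> cball 0 1 - {0}))
        (restrict_space borel (V \<inter> sphere 0 1)) sgn)"

definition spherical_radon :: "('a::euclidean_space \<Rightarrow> real) \<Rightarrow> 'a \<Rightarrow> real" where
  "spherical_radon g \<xi> = (\<integral>\<theta>. g \<theta> \<partial>sphere_measure {x. \<xi> \<bullet> x = 0})"

definition even_finite_sphere_measure :: "'a::euclidean_space measure \<Rightarrow> bool" where
  "even_finite_sphere_measure \<mu> \<longleftrightarrow>
     sets \<mu> = sets (restrict_space borel (sphere 0 1)) \<and> finite_measure \<mu> \<and>
     (\<forall>E\<in>sets \<mu>. emeasure \<mu> (uminus ` E) = emeasure \<mu> E)"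

definition intersection_body :: "'a::euclidean_space set \<Rightarrow> bool" where
  "intersection_body K \<longleftrightarrow> star_body K \<and> origin_symmetric K \<and>
     (\<exists>\<mu>. even_finite_sphere_measure \<mu> \<and>
        (\<forall>g. continuous_on (sphere 0 1) g \<longrightarrow>
           (\<integral>\<xi>. radial K \<xi> * g \<xi> \<partial>sphere_measure UNIV) = (\<integral>\<xi>. spherical_radon g \<xi> \<partial>\<mu>)))"

lemma some_onb:
  assumes "subspace V"
  shows "orthonormal_basis_of V (some_onb V)"
  unfolding some_onb_def
proof (rule someI_ex)
  show "\<exists>B. orthonormal_basis_of V B"
    using orthonormal_basis_subspace[OF assms] unfolding orthonormal_basis_of_def by metis
qed

lemma sets_subspace_lborel [simp, measurable_cong]: "sets (subspace_lborel V) = sets borel"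
  by (simp add: subspace_lborel_def)

lemma emeasure_subspace_lborel:
  assumes "X \<in> sets borel"
  shows "emeasure (subspace_lborel V) X = emeasure (\<Pi>\<^sub>M b\<in>some_onb V. lborel)
     ((\<lambda>f. \<Sum>b\<in>some_onb V. f b *\<^sub>R b) -` X \<inter> space (\<Pi>\<^sub>M b\<in>some_onb V. lborel))"
  unfolding subspace_lborel_def by (rule emeasure_distr[OF _ assms]) measurable

lemma space_sphere_measure: "space (sphere_measure V) = V \<inter> sphere 0 1"
  by (simp add: sphere_measure_def space_restrict_space space_scale_measure)

lemma sets_sphere_measure: "sets (sphere_measure V) = sets (restrict_space borel (V \<inter> sphere 0 1))"
  by (simp add: sphere_measure_def)

lemma emeasure_sphere_measure:
  fixes V :: "'a::euclidean_space set"
  assumes V: "subspace V" and E: "E \<in> sets (sphere_measure V)"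
  shows "emeasure (sphere_measure V) E =
    of_nat (dim V) * emeasure (subspace_lborel V) {r *\<^sub>R x |r x. x \<in> E \<and> 0 < r \<and> r \<le> 1}"
proof -
  let ?D = "V \<inter> cball 0 1 - {0}"
  let ?C = "{r *\<^sub>R x |r x. x \<in> E \<and> 0 < r \<and> r \<le> 1}"
  have D: "?D \<in> sets borel"
    using closed_subspace[OF V] by auto
  have "sgn \<in> restrict_space (subspace_lborel V) ?D \<rightarrow>\<^sub>M restrict_space borel (V \<inter> sphere 0 1)"
  proof (rule measurable_restrict_space3)
    show "sgn \<in> subspace_lborel V \<rightarrow>\<^sub>M borel"
      unfolding sgn_div_norm[abs_def] by measurable
    show "sgn \<in> ?D \<rightarrow> V \<inter> sphere 0 1"
      using V by (auto simp: sgn_div_norm norm_sgn subspace_scale)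
  qed
  moreover have ES: "E \<subseteq> V \<inter> sphere 0 1"
    using sets.sets_into_space[OF E] by (simp add: space_sphere_measure)
  have "sgn -` E \<inter> ?D = ?C"
  proof (intro set_eqI iffI)
    fix y assume y: "y \<in> sgn -` E \<inter> ?D"
    then have "y = norm y *\<^sub>R sgn y" by (simp add: sgn_div_norm)
    then show "y \<in> ?C" using y by (smt (verit) DiffE IntE mem_Collect_eq mem_cball_0 singletonI
        vimageE zero_less_norm_iff)
  next
    fix y assume "y \<in> ?C"
    then obtain r x where rx: "y = r *\<^sub>R x" "x \<in> E" "0 < r" "r \<le> 1" by auto
    then have "norm x = 1" "x \<in> V" using ES by auto
    with rx show "y \<in> sgn -` E \<inter> ?D"
      using V by (auto simp: sgn_div_norm subspace_scale)
  qed
  moreover have "space (subspace_lborel V) = UNIV"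
    by (simp add: subspace_lborel_def)
  moreover have "emeasure (restrict_space (subspace_lborel V) ?D) ?C = emeasure (subspace_lborel V) ?C"
    using D \<open>sgn -` E \<inter> ?D = ?C\<close> by (intro emeasure_restrict_space) auto
  ultimately show ?thesis
    using E D by (simp add: sphere_measure_def emeasure_distr space_restrict_space)
qed

lemma symmetric_convex_body_imp_star_body:
  fixes K :: "'a::euclidean_space set"
  assumes K: "convex_body K" and sym: "origin_symmetric K"
  shows "star_body K"
proof -
  have cK: "compact K" "convex K" "closed K"
    using K compact_imp_closed by (auto simp: convex_body_def)
  obtain x where x: "x \<in> interior K"
    using K by (auto simp: convex_body_def)
  have "- x \<in> interior K"
    using x sym interior_negations[of K] unfolding origin_symmetric_def by (metis imageI)
  then have "(1/2) *\<^sub>R x + (1/2) *\<^sub>R (- x) \<in> interior K"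
    using convex_interior[OF cK(2)] x by (intro convexD) auto
  then have int0: "0 \<in> interior K" by simp
  then have K0: "0 \<in> K" using interior_subset by blast
  have star: "t *\<^sub>R x \<in> K" if "x \<in> K" "t \<in> {0..1}" for x t
    using convexD_alt[OF cK(2) K0 that(1), of t] that(2) by simp
  have inner: "a *\<^sub>R \<xi> \<in> interior K" if "b *\<^sub>R \<xi> \<in> K" "0 \<le> a" "a < b" for a b \<xi>
  proof -
    have "b *\<^sub>R \<xi> - (1 - a/b) *\<^sub>R (b *\<^sub>R \<xi> - 0) \<in> interior K"
      using that by (intro mem_interior_convex_shrink[OF cK(2) int0]) auto
    then show ?thesis using that by (simp add: algebra_simps)
  qed
  obtain R where R: "\<And>x. x \<in> K \<Longrightarrow> norm x \<le> R"
    using compact_imp_bounded[OF cK(1)] bounded_iff by metis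
  have rad: "radial K \<xi> *\<^sub>R \<xi> \<in> K" "a *\<^sub>R \<xi> \<in> K \<Longrightarrow> a \<le> radial K \<xi>" if "norm \<xi> = 1" for \<xi> a
  proof -
    let ?S = "{a. a *\<^sub>R \<xi> \<in> K}"
    have "closed ((\<lambda>a. a *\<^sub>R \<xi>) -` K)"
      by (intro closed_vimage cK continuous_intros)
    moreover have "bounded ?S"
      unfolding bounded_iff using R that by force
    ultimately have "compact ?S" by (simp add: compact_eq_bounded_closed vimage_def)
    moreover have "?S \<noteq> {}" using K0 by (auto intro: exI[of _ 0])
    ultimately obtain m where m: "m \<in> ?S" "\<forall>a\<in>?S. a \<le> m"
      using compact_attains_sup by metis
    then have "radial K \<xi> = m"
      unfolding radial_def by (intro Greatest_equality) auto
    then show "radial K \<xi> *\<^sub>R \<xi> \<in> K" "a *\<^sub>R \<xi> \<in> K \<Longrightarrow> a \<le> radial K \<xi>"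
      using m by auto
  qed
  have pos: "0 \<le> radial K \<xi>" if "norm \<xi> = 1" for \<xi>
    using rad(2)[OF that, of 0] K0 by simp
  have frontier: "a = radial K \<xi> \<longleftrightarrow> 0 \<le> a \<and> a *\<^sub>R \<xi> \<in> frontier K" if \<xi>: "norm \<xi> = 1" for a \<xi>
  proof
    assume a: "a = radial K \<xi>"
    have "a *\<^sub>R \<xi> \<notin> interior K"
    proof
      assume "a *\<^sub>R \<xi> \<in> interior K"
      then obtain e where e: "e > 0" "cball (a *\<^sub>R \<xi>) e \<subseteq> K"
        using mem_interior_cball by blast
      have "(a + e) *\<^sub>R \<xi> \<in> cball (a *\<^sub>R \<xi>) e"
        using e(1) \<xi> by (simp add: dist_norm scaleR_left_distrib)
      then have "(a + e) *\<^sub>R \<xi> \<in> K" using e(2) by blast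
      then show False using e(1) rad(2)[OF \<xi>, of "a + e"] a by simp
    qed
    then show "0 \<le> a \<and> a *\<^sub>R \<xi> \<in> frontier K"
      using pos[OF \<xi>] rad(1)[OF \<xi>] a cK(3) by (auto simp: frontier_def closure_closed)
  next
    assume a: "0 \<le> a \<and> a *\<^sub>R \<xi> \<in> frontier K"
    then have "a *\<^sub>R \<xi> \<in> K" "a *\<^sub>R \<xi> \<notin> interior K"
      using cK(3) by (auto simp: frontier_def closure_closed)
    then show "a = radial K \<xi>"
      using inner[OF rad(1)[OF \<xi>], of a] rad(2)[OF \<xi>, of a] a by force
  qed
  have "continuous_on (sphere 0 1) (radial K)"
  proof (rule continuous_from_closed_graph)
    show "compact {0..R}" by simp
    show "radial K \<in> sphere 0 1 \<rightarrow> {0..R}"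
    proof
      fix \<xi> :: 'a assume "\<xi> \<in> sphere 0 1"
      then have \<xi>: "norm \<xi> = 1" by simp
      show "radial K \<xi> \<in> {0..R}"
        using R[OF rad(1)[OF \<xi>]] pos[OF \<xi>] \<xi> by simp
    qed
    have "(\<lambda>x. (x, radial K x)) ` sphere 0 1 =
        (sphere 0 1 \<times> {0..}) \<inter> (\<lambda>p. snd p *\<^sub>R fst p) -` frontier K"
      using frontier[OF _, THEN iffD1, OF _ refl] frontier[OF _, THEN iffD2] by (force simp: image_iff)
    moreover have "closed ((sphere (0::'a) 1 \<times> {0::real..}) \<inter> (\<lambda>p. snd p *\<^sub>R fst p) -` frontier K)"
      by (intro closed_Int closed_Times closed_vimage continuous_intros closed_sphere closed_atLeast
          frontier_closed)
    ultimately show "closed ((\<lambda>x. (x, radial K x)) ` sphere 0 1)" by simp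
  qed
  then show ?thesis
    using cK int0 star by (simp add: star_body_def)
qed

end

theory Submission
  imports Defs
begin

text \<open>
  Write \<open>K\<close> as a cylinder \<open>{y + t a | y \<in> K \<inter> H, \<bar>t\<bar> \<le> 1}\<close>. For a Gaussian \<open>\<psi>\<close> and a vector \<open>v\<close>, the integrals
  of \<open>\<psi>(x)\<close>, \<open>\<psi>(x - v)\<close>, \<open>\<psi>(x - 2v)\<close> over a hyperplane through the origin are proportional to
  \<open>1, q, q^4\<close>, and \<open>3 - 4q + q^4 = (1 - q)^2 (3 + 2q + q^2) \<ge> 0\<close>. In polar coordinates these are
  spherical Radon transforms, so for an intersection body the integrals \<open>F(v)\<close> of
  \<open>\<rho>\<^sub>K(x) \<psi>(x - v)\<close> satisfy \<open>3 F(0) - 4 F(v) + F(2v) \<ge> 0\<close>. Take \<open>v = s a\<close> and let the Gaussian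
  degenerate to a Gaussian measure on \<open>H\<close>: the limit \<open>D(s)\<close> of \<open>F(0) - F(s a)\<close> satisfies
  \<open>D(2s) \<le> 4 D(s)\<close>. Since \<open>\<rho>\<^sub>K(y + s a) = min(\<rho>\<^sub>K(y), 1/s)\<close> differs from \<open>\<rho>\<^sub>K(y)\<close> only where \<open>y\<close>
  is of size \<open>O(s)\<close> and \<open>dim H \<ge> 4\<close>, we have \<open>D(s) = O(s^(5/2))\<close>; iterating the doubling
  inequality gives \<open>D = 0\<close>, which is absurd because \<open>\<rho>\<^sub>K(y + s a) < \<rho>\<^sub>K(y)\<close> for large \<open>s\<close>.
\<close>

section \<open>Lebesgue measure on subspaces\<close>

lemma
  assumes "subspace V"
  shows finite_some_onb: "finite (some_onb V)"
    and card_some_onb: "card (some_onb V) = dim V"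
    and span_some_onb: "span (some_onb V) = V"
    and inner_some_onb: "b \<in> some_onb V \<Longrightarrow> (\<Sum>c\<in>some_onb V. f c *\<^sub>R c) \<bullet> b = f b"
proof -
  have B: "some_onb V \<subseteq> V" "pairwise orthogonal (some_onb V)" "\<forall>b\<in>some_onb V. norm b = 1" "span (some_onb V) = V"
    using some_onb[OF assms] by (auto simp: orthonormal_basis_of_def)
  then have "independent (some_onb V)"
    by (intro pairwise_orthogonal_independent) auto
  with B show fin: "finite (some_onb V)" "card (some_onb V) = dim V" "span (some_onb V) = V"
    using independent_imp_finite basis_card_eq_dim[of "some_onb V" V] by auto
  assume b: "b \<in> some_onb V"
  have "(\<Sum>c\<in>some_onb V. f c *\<^sub>R c) \<bullet> b = (\<Sum>c\<in>some_onb V. if c = b then f b else 0)"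
    using B(2,3) b by (auto simp: inner_sum_left pairwise_def orthogonal_def dot_square_norm intro!: sum.cong)
  then show "(\<Sum>c\<in>some_onb V. f c *\<^sub>R c) \<bullet> b = f b"
    using b fin by simp
qed

lemma expansion_some_onb:
  assumes "subspace V" "x \<in> V"
  shows "(\<Sum>b\<in>some_onb V. (x \<bullet> b) *\<^sub>R b) = x"
proof -
  obtain u where u: "x = (\<Sum>b\<in>some_onb V. u b *\<^sub>R b)"
    using assms span_some_onb[OF assms(1)] span_finite[OF finite_some_onb[OF assms(1)]] by auto
  show ?thesis
    unfolding u using inner_some_onb[OF assms(1), of _ u] by simp
qed

lemma nn_integral_subspace_lborel:
  assumes "h \<in> borel_measurable borel"
  shows "(\<integral>\<^sup>+x. h x \<partial>subspace_lborel V) =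
    (\<integral>\<^sup>+f. h (\<Sum>b\<in>some_onb V. f b *\<^sub>R b) \<partial>(\<Pi>\<^sub>M b\<in>some_onb V. lborel))"
  unfolding subspace_lborel_def using assms by (intro nn_integral_distr) measurable

lemma space_subspace_lborel [simp]: "space (subspace_lborel V) = UNIV"
  by (simp add: subspace_lborel_def)

lemma AE_subspace_lborel:
  fixes V :: "'a::euclidean_space set"
  assumes "subspace V"
  shows "AE x in subspace_lborel V. x \<in> V"
proof -
  have [measurable]: "V \<in> sets borel"
    using closed_subspace[OF assms] by auto
  have "(\<Sum>b\<in>some_onb V. f b *\<^sub>R b) \<in> V" for f
    using some_onb[OF assms]
    by (intro subspace_sum subspace_scale assms) (auto simp: orthonormal_basis_of_def)
  then show ?thesis
    unfolding subspace_lborel_def by (subst AE_distr_iff) auto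
qed

text \<open>It suffices to compare both measures on boxes, where each coordinate contributes one
  factor \<open>\<bar>c\<bar>\<close> by the one-dimensional change of variables.\<close>

lemma PiM_lborel_affine:
  fixes t :: "'i \<Rightarrow> real"
  assumes "finite I" "c \<noteq> 0"
  shows "(\<Pi>\<^sub>M i\<in>I. lborel) =
    density (distr (\<Pi>\<^sub>M i\<in>I. lborel) (\<Pi>\<^sub>M i\<in>I. lborel) (\<lambda>f. \<lambda>i\<in>I. t i + c * f i))
      (\<lambda>_. ennreal (\<bar>c\<bar> ^ card I))"
proof -
  interpret product_sigma_finite "\<lambda>_::'i. lborel :: real measure" ..
  let ?P = "\<Pi>\<^sub>M i\<in>I. (lborel :: real measure)" and ?T = "\<lambda>f. \<lambda>i\<in>I. t i + c * f i"
  have T[measurable]: "?T \<in> ?P \<rightarrow>\<^sub>M ?P"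
    by measurable
  show ?thesis
  proof (rule PiM_eqI[symmetric])
    fix A :: "'i \<Rightarrow> real set" assume A: "\<And>i. i \<in> I \<Longrightarrow> A i \<in> sets lborel"
    have vA: "(\<lambda>x. t i + c * x) -` A i \<in> sets lborel" if "i \<in> I" for i
    proof -
      have "(\<lambda>x. t i + c * x) \<in> borel_measurable borel" by measurable
      then show ?thesis using measurable_sets[of "\<lambda>x. t i + c * x" borel borel "A i"] A[OF that] by simp
    qed
    have eq: "emeasure lborel (A i) = ennreal \<bar>c\<bar> * emeasure lborel ((\<lambda>x. t i + c * x) -` A i)" if "i \<in> I" for i
    proof -
      have "emeasure lborel (A i) = (\<integral>\<^sup>+x. indicator (A i) x \<partial>lborel)"
        using A[OF that] by simp
      also have "\<dots> = ennreal \<bar>c\<bar> * (\<integral>\<^sup>+x. indicator (A i) (t i + c * x) \<partial>lborel)"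
        using A[OF that] assms by (intro nn_integral_real_affine) auto
      also have "(\<integral>\<^sup>+x. indicator (A i) (t i + c * x) \<partial>lborel) = (\<integral>\<^sup>+x. indicator ((\<lambda>x. t i + c * x) -` A i) x \<partial>lborel)"
        by (intro nn_integral_cong) (auto simp: indicator_def)
      finally show ?thesis using vA[OF that] by simp
    qed
    have AP: "Pi\<^sub>E I A \<in> sets ?P"
      using A assms by (intro sets_PiM_I_finite) auto
    have "?T -` Pi\<^sub>E I A \<inter> space ?P = (\<Pi>\<^sub>E i\<in>I. (\<lambda>x. t i + c * x) -` A i)"
      by (auto simp: space_PiM PiE_iff)
    then have "emeasure (density (distr ?P ?P ?T) (\<lambda>_. ennreal (\<bar>c\<bar> ^ card I))) (Pi\<^sub>E I A) =
        ennreal (\<bar>c\<bar> ^ card I) * (\<Prod>i\<in>I. emeasure lborel ((\<lambda>x. t i + c * x) -` A i))"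
      using AP assms vA by (subst emeasure_density_const) (simp_all add: emeasure_distr emeasure_PiM)
    also have "\<dots> = (\<Prod>i\<in>I. emeasure lborel (A i))"
      by (simp add: eq prod.distrib ennreal_power)
    finally show "emeasure (density (distr ?P ?P ?T) (\<lambda>_. ennreal (\<bar>c\<bar> ^ card I))) (Pi\<^sub>E I A) =
        (\<Prod>i\<in>I. emeasure lborel (A i))" .
  qed (use assms in simp_all)
qed

text \<open>In orthonormal coordinates the map is affine in each coordinate;
  \<open>v \<in> V\<close> ensures that the coordinates \<open>v \<bullet> b\<close> rebuild
  \<open>v\<close>. Serves both for translations (\<open>c = 1\<close>) and for dilations
  (\<open>v = 0\<close>).\<close>

lemma nn_integral_subspace_lborel_affine:
  fixes V :: "'a::euclidean_space set"
  assumes V: "subspace V" and h[measurable]: "h \<in> borel_measurable borel" and c: "c \<noteq> 0" and v: "v \<in> V"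
  shows "(\<integral>\<^sup>+x. h x \<partial>subspace_lborel V) =
    ennreal (\<bar>c\<bar> ^ dim V) * (\<integral>\<^sup>+x. h (v + c *\<^sub>R x) \<partial>subspace_lborel V)"
proof -
  let ?B = "some_onb V"
  let ?P = "\<Pi>\<^sub>M b\<in>?B. (lborel :: real measure)" and ?T = "\<lambda>f. \<lambda>b\<in>?B. v \<bullet> b + c * f b"
  let ?S = "\<lambda>f. \<Sum>b\<in>?B. f b *\<^sub>R b"
  have T[measurable]: "?T \<in> ?P \<rightarrow>\<^sub>M ?P" by measurable
  have S[measurable]: "?S \<in> borel_measurable ?P" by measurable
  have ST: "?S (?T f) = v + c *\<^sub>R ?S f" for f
    using expansion_some_onb[OF V v]
    by (simp add: scaleR_add_left sum.distrib scaleR_sum_right)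
  have "(\<integral>\<^sup>+x. h x \<partial>subspace_lborel V) =
      (\<integral>\<^sup>+f. h (?S f) \<partial>density (distr ?P ?P ?T) (\<lambda>_. ennreal (\<bar>c\<bar> ^ card ?B)))"
    unfolding nn_integral_subspace_lborel[OF h]
    by (subst PiM_lborel_affine[OF finite_some_onb[OF V] c]) (rule refl)
  also have "\<dots> = ennreal (\<bar>c\<bar> ^ card ?B) * (\<integral>\<^sup>+f. h (?S (?T f)) \<partial>?P)"
    by (subst nn_integral_density) (simp_all add: nn_integral_cmult nn_integral_distr)
  finally show ?thesis
    by (simp only: ST card_some_onb[OF V]) (subst nn_integral_subspace_lborel, simp_all)
qed

text \<open>By Cauchy-Schwarz every coordinate of a point of the ball is bounded by
  \<open>r\<close>, so the ball pulls back into a cube.\<close>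

lemma emeasure_subspace_lborel_cball:
  fixes V :: "'a::euclidean_space set"
  assumes V: "subspace V"
  shows "emeasure (subspace_lborel V) (cball 0 r) < \<infinity>"
proof -
  interpret product_sigma_finite "\<lambda>_::'a. lborel :: real measure" ..
  let ?B = "some_onb V"
  let ?P = "\<Pi>\<^sub>M b\<in>?B. (lborel :: real measure)"
  let ?A = "\<Pi>\<^sub>E b\<in>?B. {-r..r}"
  have "f \<in> ?A" if f: "f \<in> space ?P" "norm (\<Sum>b\<in>?B. f b *\<^sub>R b) \<le> r" for f
  proof -
    have "-r \<le> f b \<and> f b \<le> r" if b: "b \<in> ?B" for b
    proof -
      have "norm b = 1" using some_onb[OF V] b by (auto simp: orthonormal_basis_of_def)
      then show ?thesis
        using Cauchy_Schwarz_ineq2[of "\<Sum>b\<in>?B. f b *\<^sub>R b" b] f(2) inner_some_onb[OF V b, of f] by auto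
    qed
    then show ?thesis using f(1) by (simp add: space_PiM PiE_iff)
  qed
  then have "(\<lambda>f. \<Sum>b\<in>?B. f b *\<^sub>R b) -` cball 0 r \<inter> space ?P \<subseteq> ?A"
    by (intro subsetI) simp
  then have "emeasure (subspace_lborel V) (cball 0 r) \<le> emeasure ?P ?A"
    unfolding emeasure_subspace_lborel[OF borel_closed[OF closed_cball]]
    by (rule emeasure_mono) (auto intro!: sets_PiM_I_finite finite_some_onb[OF V])
  also have "\<dots> = (\<Prod>b\<in>?B. emeasure lborel {-r..r})"
    by (intro emeasure_PiM finite_some_onb[OF V]) auto
  also have "\<dots> < \<infinity>"
    by (simp add: power_less_top_ennreal emeasure_lborel_Icc_eq)
  finally show ?thesis .
qed

lemma sigma_finite_subspace_lborel:
  fixes V :: "'a::euclidean_space set"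
  assumes V: "subspace V"
  shows "sigma_finite_measure (subspace_lborel V)"
proof
  have "(\<Union>n::nat. cball (0::'a) (real n)) = UNIV"
    using real_arch_simple by auto
  then show "\<exists>A. countable A \<and> A \<subseteq> sets (subspace_lborel V) \<and> \<Union> A = space (subspace_lborel V) \<and>
      (\<forall>a\<in>A. emeasure (subspace_lborel V) a \<noteq> \<infinity>)"
    using emeasure_subspace_lborel_cball[OF V]
    by (intro exI[of _ "range (\<lambda>n::nat. cball 0 (real n))"]) (auto simp: less_top[symmetric])
qed

text \<open>Doubling fixes \<open>{0}\<close> but scales measure by \<open>2 ^ dim V\<close>, which
  is impossible for a finite positive mass.\<close>

lemma emeasure_subspace_lborel_0:
  fixes V :: "'a::euclidean_space set"
  assumes V: "subspace V" and "dim V \<noteq> 0"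
  shows "emeasure (subspace_lborel V) {0} = 0"
proof -
  let ?m = "emeasure (subspace_lborel V) {0}"
  have "?m = ennreal (\<bar>2\<bar> ^ dim V) * (\<integral>\<^sup>+x. indicator {0} (0 + 2 *\<^sub>R x) \<partial>subspace_lborel V)"
    by (subst nn_integral_subspace_lborel_affine[OF V, symmetric]) (auto simp: subspace_0[OF V])
  also have "(\<lambda>x::'a. indicator {0} (0 + 2 *\<^sub>R x) :: ennreal) = indicator {0}"
    by (auto simp: indicator_def)
  finally have "?m = ennreal (2 ^ dim V) * ?m"
    by simp
  moreover have "?m < \<infinity>"
    using emeasure_mono[of "{0}" "cball 0 1" "subspace_lborel V"] emeasure_subspace_lborel_cball[OF V, of 1]
    by (auto simp: less_top intro: le_less_trans)
  then obtain m where m: "?m = ennreal m" "0 \<le> m"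
    by (cases ?m) auto
  ultimately have "m = 2 ^ dim V * m"
    by (simp add: ennreal_mult[symmetric])
  moreover have "(2::real) ^ dim V \<noteq> 1"
    using assms(2) by (metis one_less_numeral_iff one_less_power order_less_irrefl semiring_norm(76) bot_nat_0.not_eq_extremum)
  ultimately show ?thesis using m by simp
qed

section \<open>Polar coordinates and uniqueness of translation invariant measures\<close>

lemma nn_integral_sphere_measure:
  fixes V :: "'a::euclidean_space set"
  assumes V: "subspace V" and h: "h \<in> borel_measurable (restrict_space borel (V \<inter> sphere 0 1))"
  shows "(\<integral>\<^sup>+\<theta>. h \<theta> \<partial>sphere_measure V) =
    of_nat (dim V) * (\<integral>\<^sup>+x. h (sgn x) * indicator (V \<inter> cball 0 1 - {0}) x \<partial>subspace_lborel V)"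
proof -
  let ?D = "V \<inter> cball 0 1 - {0}"
  have D: "?D \<in> sets borel"
    using closed_subspace[OF V] by auto
  have sgn: "sgn \<in> restrict_space (subspace_lborel V) ?D \<rightarrow>\<^sub>M restrict_space borel (V \<inter> sphere 0 1)"
  proof (rule measurable_restrict_space3)
    show "sgn \<in> subspace_lborel V \<rightarrow>\<^sub>M borel"
      unfolding sgn_div_norm[abs_def] by measurable
    show "sgn \<in> ?D \<rightarrow> V \<inter> sphere 0 1"
      using V by (auto simp: sgn_div_norm norm_sgn subspace_scale)
  qed
  show ?thesis
    unfolding sphere_measure_def
    using h sgn D
    by (subst nn_integral_scale_measure)
      (simp_all add: nn_integral_distr nn_integral_restrict_space)
qed

lemma finite_sphere_measure:
  fixes V :: "'a::euclidean_space set"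
  assumes V: "subspace V"
  shows "finite_measure (sphere_measure V)"
proof
  have "emeasure (sphere_measure V) (space (sphere_measure V)) = (\<integral>\<^sup>+\<theta>. 1 \<partial>sphere_measure V)"
    by simp
  also have "\<dots> = of_nat (dim V) * (\<integral>\<^sup>+x. indicator (V \<inter> cball 0 1 - {0}) x \<partial>subspace_lborel V)"
    by (subst nn_integral_sphere_measure[OF V]) simp_all
  also have "\<dots> \<le> of_nat (dim V) * (\<integral>\<^sup>+x. indicator (cball 0 1) x \<partial>subspace_lborel V)"
    by (intro mult_left_mono nn_integral_mono) (auto simp: indicator_def)
  also have "\<dots> < \<infinity>"
    using emeasure_subspace_lborel_cball[OF V, of 1] by (simp add: ennreal_mult_less_top of_nat_less_top)
  finally show "emeasure (sphere_measure V) (space (sphere_measure V)) \<noteq> \<infinity>" by simp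
qed

lemma nn_integral_inverse_power_atLeast:
  assumes "0 < a"
  shows "(\<integral>\<^sup>+t. ennreal (1 / t ^ Suc (Suc k)) * indicator {a..} t \<partial>lborel) = ennreal (1 / (real (Suc k) * a ^ Suc k))"
proof -
  let ?F = "\<lambda>t::real. - (1 / (real (Suc k) * t ^ Suc k))"
  have "(\<integral>\<^sup>+t. ennreal (1 / t ^ Suc (Suc k)) * indicator {a..} t \<partial>lborel) = ennreal (0 - ?F a)"
  proof (rule nn_integral_FTC_atLeast)
    show "DERIV ?F t :> 1 / t ^ Suc (Suc k)" if "a \<le> t" for t
    proof -
      have t: "t > 0" using that assms by simp
      have "DERIV (\<lambda>t. t ^ Suc k) t :> real (Suc k) * t ^ k"
        using DERIV_pow[of "Suc k" t] by simp
      from DERIV_minus[OF DERIV_cmult[OF DERIV_inverse_fun[OF this], of "inverse (real (Suc k))"]]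
      have deriv: "((\<lambda>t. - (inverse (real (Suc k)) * inverse (t ^ Suc k))) has_real_derivative
          - (inverse (real (Suc k)) * - (real (Suc k) * t ^ k * inverse ((t ^ Suc k) ^ Suc (Suc 0))))) (at t)"
        using t by simp
      have eq: "- (inverse (real (Suc k)) * - (real (Suc k) * t ^ k * inverse ((t ^ Suc k) ^ Suc (Suc 0))))
          = 1 / t ^ Suc (Suc k)"
        using t by (simp add: field_simps del: of_nat_Suc)
      show ?thesis
        using DERIV_cong[OF deriv eq] by (simp only: divide_inverse mult_1_left inverse_mult_distrib)
    qed
    show "(?F \<longlongrightarrow> 0) at_top"
      by (rule tendsto_eq_rhs, rule tendsto_minus, rule tendsto_divide_0[OF tendsto_const])
        (auto intro!: filterlim_at_top_imp_at_infinity filterlim_tendsto_pos_mult_at_top[OF tendsto_const]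
          filterlim_pow_at_top filterlim_ident simp del: power_Suc of_nat_Suc)
  qed (use assms in auto)
  then show ?thesis by simp
qed

text \<open>The surface measure is known only through solid cones, so the left side is first an
  integral over the punctured unit ball \<open>D\<close>. Substituting \<open>r = norm x * t\<close>
  and then \<open>x = y / t\<close> turns the ball constraint into \<open>norm y \<le> t\<close>.
  The remaining integral of \<open>1 / t ^ Suc (Suc k)\<close> over \<open>t \<ge> norm y\<close>
  cancels both the factor \<open>dim V\<close> and \<open>norm y ^ Suc k\<close>.\<close>

lemma polar_coordinates:
  fixes V :: "'a::euclidean_space set"
  assumes V: "subspace V" "dim V = Suc k" and h[measurable]: "h \<in> borel_measurable borel"
  shows "(\<integral>\<^sup>+\<theta>. (\<integral>\<^sup>+r. ennreal (r ^ k) * h (r *\<^sub>R \<theta>) * indicator {0<..} r \<partial>lborel) \<partial>sphere_measure V) =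
    (\<integral>\<^sup>+x. h x \<partial>subspace_lborel V)"
proof -
  let ?L = "subspace_lborel V"
  define D where "D = V \<inter> cball 0 1 - {0}"
  define D' where "D' = V - {0}"
  have [measurable]: "D \<in> sets borel" "D' \<in> sets borel"
    using closed_subspace[OF V(1)] unfolding D_def D'_def by auto
  interpret V: sigma_finite_measure ?L
    by (rule sigma_finite_subspace_lborel[OF V(1)])
  interpret V: pair_sigma_finite ?L "lborel :: real measure" ..
  \<comment> \<open>The integrand after \<open>r = norm x * t\<close>; one of the factors
    \<open>norm x\<close> comes from the differential.\<close>
  define F where "F x t = ennreal (norm x ^ Suc k * t ^ k) * h (t *\<^sub>R x) * indicator D x * indicator {0<..} t"
    for x :: 'a and t :: real
  \<comment> \<open>This is \<open>F\<close> at \<open>x = y / t\<close> together with the Jacobian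
    \<open>1 / t ^ Suc k\<close>.\<close>
  define G where "G y t = ennreal (norm y ^ Suc k) * h y * indicator D' y *
      (ennreal (1 / t ^ Suc (Suc k)) * (if norm y \<le> t then 1 else 0))" for y :: 'a and t :: real
  have Fm[measurable]: "case_prod F \<in> borel_measurable (?L \<Otimes>\<^sub>M lborel)"
    unfolding F_def by measurable
  have Gm[measurable]: "case_prod G \<in> borel_measurable (?L \<Otimes>\<^sub>M lborel)"
    unfolding G_def by measurable
  have G: "G y t = ennreal (norm y ^ Suc k) * h y * indicator D' y *
      (ennreal (1 / t ^ Suc (Suc k)) * indicator {norm y..} t)" for y t
    by (simp add: G_def indicator_def)
  have radial: "(\<integral>\<^sup>+r. ennreal (r ^ k) * h (r *\<^sub>R sgn x) * indicator {0<..} r \<partial>lborel) * indicator D x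
      = (\<integral>\<^sup>+t. F x t \<partial>lborel)" for x
  proof (cases "x \<in> D")
    case True
    then have x: "norm x > 0" by (simp add: D_def)
    have "(\<integral>\<^sup>+r. ennreal (r ^ k) * h (r *\<^sub>R sgn x) * indicator {0<..} r \<partial>lborel) =
       ennreal \<bar>norm x\<bar> * (\<integral>\<^sup>+t. ennreal ((0 + norm x * t) ^ k) * h ((0 + norm x * t) *\<^sub>R sgn x) * indicator {0<..} (0 + norm x * t) \<partial>lborel)"
      using x by (intro nn_integral_real_affine) auto
    also have "\<dots> = (\<integral>\<^sup>+t. ennreal \<bar>norm x\<bar> * (ennreal ((0 + norm x * t) ^ k) * h ((0 + norm x * t) *\<^sub>R sgn x) * indicator {0<..} (0 + norm x * t)) \<partial>lborel)"
      by (subst nn_integral_cmult) auto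
    also have "\<dots> = (\<integral>\<^sup>+t. F x t \<partial>lborel)"
    proof (rule nn_integral_cong)
      fix t :: real
      have "(norm x * t) *\<^sub>R sgn x = t *\<^sub>R x"
        using x by (simp add: sgn_div_norm)
      moreover have "ennreal (norm x) * ennreal ((norm x * t) ^ k) = ennreal (norm x ^ Suc k * t ^ k)" if "t > 0"
        using that by (subst ennreal_mult[symmetric]) (auto simp: power_mult_distrib ac_simps)
      ultimately show "ennreal \<bar>norm x\<bar> * (ennreal ((0 + norm x * t) ^ k) * h ((0 + norm x * t) *\<^sub>R sgn x) * indicator {0<..} (0 + norm x * t)) = F x t"
        using x True by (simp add: F_def zero_less_mult_iff mult.assoc[symmetric] split: split_indicator)
    qed
    finally show ?thesis using True by simp
  qed (simp add: F_def)
  have scale: "(\<integral>\<^sup>+x. F x t \<partial>?L) = (\<integral>\<^sup>+y. G y t \<partial>?L)" for t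
  proof (cases "t > 0")
    case t: True
    have Fm1: "(\<lambda>x. F x t) \<in> borel_measurable borel"
      unfolding F_def by measurable
    have "(\<integral>\<^sup>+x. F x t \<partial>?L) = ennreal (\<bar>1/t\<bar> ^ dim V) * (\<integral>\<^sup>+x. F (0 + (1/t) *\<^sub>R x) t \<partial>?L)"
      using t by (intro nn_integral_subspace_lborel_affine[OF V(1) Fm1]) (auto simp: subspace_0[OF V(1)])
    also have "\<dots> = (\<integral>\<^sup>+x. ennreal (\<bar>1/t\<bar> ^ dim V) * F (0 + (1/t) *\<^sub>R x) t \<partial>?L)"
      unfolding F_def by (subst nn_integral_cmult) auto
    also have "\<dots> = (\<integral>\<^sup>+y. G y t \<partial>?L)"
    proof (rule nn_integral_cong)
      fix y
      have "(1/t) *\<^sub>R y \<in> V \<longleftrightarrow> y \<in> V"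
        using t subspace_scale[OF V(1), of y "1/t"] subspace_scale[OF V(1), of "(1/t) *\<^sub>R y" t] by auto
      then have D: "(1/t) *\<^sub>R y \<in> D \<longleftrightarrow> y \<in> D' \<and> norm y \<le> t"
        using t by (auto simp: D_def D'_def field_simps)
      have eq: "ennreal (\<bar>1/t\<bar> ^ Suc k) * ennreal (norm ((1/t) *\<^sub>R y) ^ Suc k * t ^ k) =
          ennreal (norm y ^ Suc k) * ennreal (1 / t ^ Suc (Suc k))"
        using t by (simp add: ennreal_mult[symmetric] power_divide field_simps del: power_Suc)
          (simp add: field_simps)
      have "ennreal (\<bar>1/t\<bar> ^ dim V) * F (0 + (1/t) *\<^sub>R y) t =
          (ennreal (\<bar>1/t\<bar> ^ Suc k) * ennreal (norm ((1/t) *\<^sub>R y) ^ Suc k * t ^ k)) * h y * indicator D ((1/t) *\<^sub>R y)"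
        using t by (simp add: F_def V(2) mult.assoc del: power_Suc)
      also have "\<dots> = G y t"
        unfolding eq using D by (auto simp: G_def indicator_def ac_simps)
      finally show "ennreal (\<bar>1/t\<bar> ^ dim V) * F (0 + (1/t) *\<^sub>R y) t = G y t" .
    qed
    finally show ?thesis .
  next
    case False
    \<comment> \<open>For \<open>t \<le> 0\<close> the constraint in \<open>G\<close> leaves at most
      the origin, which \<open>D'\<close> excludes.\<close>
    then have "norm x \<le> t \<Longrightarrow> x = 0" for x :: 'a
      by (meson dual_order.strict_trans1 zero_less_norm_iff)
    then have "F x t = 0" "G x t = 0" for x
      using False by (auto simp: F_def G_def D'_def indicator_def)
    then show ?thesis by simp
  qed
  have "(\<integral>\<^sup>+\<theta>. (\<integral>\<^sup>+r. ennreal (r ^ k) * h (r *\<^sub>R \<theta>) * indicator {0<..} r \<partial>lborel) \<partial>sphere_measure V) =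
      of_nat (Suc k) * (\<integral>\<^sup>+x. (\<integral>\<^sup>+t. F x t \<partial>lborel) \<partial>?L)"
    by (subst nn_integral_sphere_measure[OF V(1)]) (simp_all add: radial[unfolded D_def] V(2) measurable_restrict_space1)
  also have "(\<integral>\<^sup>+x. (\<integral>\<^sup>+t. F x t \<partial>lborel) \<partial>?L) = (\<integral>\<^sup>+t. (\<integral>\<^sup>+y. G y t \<partial>?L) \<partial>lborel)"
    by (subst V.Fubini'[OF Fm, symmetric]) (simp add: scale)
  also have "\<dots> = (\<integral>\<^sup>+y. (\<integral>\<^sup>+t. G y t \<partial>lborel) \<partial>?L)"
    by (rule V.Fubini'[OF Gm])
  also have "of_nat (Suc k) * \<dots> = (\<integral>\<^sup>+y. of_nat (Suc k) * (\<integral>\<^sup>+t. G y t \<partial>lborel) \<partial>?L)"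
    by (subst nn_integral_cmult) auto
  also have "\<dots> = (\<integral>\<^sup>+y. h y \<partial>?L)"
  proof (rule nn_integral_cong_AE)
    have "AE y in ?L. y \<noteq> 0"
      using emeasure_subspace_lborel_0[OF V(1)] V(2) by (intro AE_I[of _ _ "{0}"]) auto
    then show "AE y in ?L. of_nat (Suc k) * (\<integral>\<^sup>+t. G y t \<partial>lborel) = h y"
      using AE_subspace_lborel[OF V(1)]
    proof eventually_elim
      fix y :: 'a assume y: "y \<noteq> 0" "y \<in> V"
      have "(\<integral>\<^sup>+t. G y t \<partial>lborel) = ennreal (norm y ^ Suc k) * h y * ennreal (1 / (real (Suc k) * norm y ^ Suc k))"
        unfolding G using y
        by (subst nn_integral_cmult) (simp_all add: nn_integral_inverse_power_atLeast D'_def del: power_Suc of_nat_Suc)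
      moreover have "ennreal (real (Suc k)) * (ennreal (norm y ^ Suc k) * ennreal (1 / (real (Suc k) * norm y ^ Suc k))) = 1"
        using y by (simp add: ennreal_mult[symmetric] del: power_Suc of_nat_Suc)
      ultimately show "of_nat (Suc k) * (\<integral>\<^sup>+t. G y t \<partial>lborel) = h y"
        by (metis ennreal_of_nat_eq_real_of_nat mult.assoc mult.commute mult.left_neutral)
    qed
  qed
  finally show ?thesis .
qed

text \<open>The uniqueness argument for Haar measure: the double integral of
  \<open>f (y + x) * g y\<close> is taken in both orders, translating \<open>x\<close> by
  \<open>y\<close> under \<open>\<mu>\<close> and \<open>y\<close> by \<open>- x\<close> under
  \<open>\<nu>\<close>. A last translation under \<open>\<mu>\<close> leaves the reflected
  \<open>g\<close>.\<close>

lemma translation_invariant_measure_unique: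
  fixes \<mu> \<nu> :: "'a::euclidean_space measure"
  assumes sets[measurable_cong]: "sets \<mu> = sets borel" "sets \<nu> = sets borel"
    and sf: "sigma_finite_measure \<mu>" "sigma_finite_measure \<nu>"
    and \<mu>: "\<And>h v. h \<in> borel_measurable borel \<Longrightarrow> (\<integral>\<^sup>+x. h (v + x) \<partial>\<mu>) = (\<integral>\<^sup>+x. h x \<partial>\<mu>)"
    and \<nu>: "\<And>h v. h \<in> borel_measurable borel \<Longrightarrow> (\<integral>\<^sup>+x. h (v + x) \<partial>\<nu>) = (\<integral>\<^sup>+x. h x \<partial>\<nu>)"
    and [measurable]: "f \<in> borel_measurable borel" "g \<in> borel_measurable borel"
  shows "(\<integral>\<^sup>+x. f x \<partial>\<mu>) * (\<integral>\<^sup>+y. g y \<partial>\<nu>) = (\<integral>\<^sup>+x. f x \<partial>\<nu>) * (\<integral>\<^sup>+y. g (- y) \<partial>\<mu>)"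
proof -
  interpret \<mu>: sigma_finite_measure \<mu> by fact
  interpret \<nu>: sigma_finite_measure \<nu> by fact
  interpret P: pair_sigma_finite \<mu> \<nu> ..
  have "(\<integral>\<^sup>+x. f x \<partial>\<mu>) * (\<integral>\<^sup>+y. g y \<partial>\<nu>) = (\<integral>\<^sup>+y. (\<integral>\<^sup>+x. f x \<partial>\<mu>) * g y \<partial>\<nu>)"
    by (simp add: nn_integral_cmult)
  also have "\<dots> = (\<integral>\<^sup>+y. (\<integral>\<^sup>+x. f (y + x) * g y \<partial>\<mu>) \<partial>\<nu>)"
    by (simp add: nn_integral_multc \<mu>)
  also have "\<dots> = (\<integral>\<^sup>+x. (\<integral>\<^sup>+y. f (y + x) * g y \<partial>\<nu>) \<partial>\<mu>)"
    by (rule P.Fubini') measurable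
  also have "\<dots> = (\<integral>\<^sup>+x. (\<integral>\<^sup>+y. f y * g (- x + y) \<partial>\<nu>) \<partial>\<mu>)"
  proof (rule nn_integral_cong)
    fix x
    show "(\<integral>\<^sup>+y. f (y + x) * g y \<partial>\<nu>) = (\<integral>\<^sup>+y. f y * g (- x + y) \<partial>\<nu>)"
      using \<nu>[of "\<lambda>y. f y * g (- x + y)" x] by (simp add: add.commute)
  qed
  also have "\<dots> = (\<integral>\<^sup>+y. (\<integral>\<^sup>+x. f y * g (- x + y) \<partial>\<mu>) \<partial>\<nu>)"
    by (rule P.Fubini'[symmetric]) measurable
  also have "\<dots> = (\<integral>\<^sup>+y. f y * (\<integral>\<^sup>+x. g (- x) \<partial>\<mu>) \<partial>\<nu>)"
  proof (rule nn_integral_cong)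
    fix y
    show "(\<integral>\<^sup>+x. f y * g (- x + y) \<partial>\<mu>) = f y * (\<integral>\<^sup>+x. g (- x) \<partial>\<mu>)"
      using \<mu>[of "\<lambda>x. g (- x + y)" y] by (simp add: nn_integral_cmult)
  qed
  also have "\<dots> = (\<integral>\<^sup>+x. f x \<partial>\<nu>) * (\<integral>\<^sup>+y. g (- y) \<partial>\<mu>)"
    by (simp add: nn_integral_multc)
  finally show ?thesis .
qed

text \<open>Taking for \<open>g\<close> the indicator of the unit ball, whose symmetry removes the
  reflection, the uniqueness identity gives \<open>c\<close> as the quotient of the two masses of
  the ball.\<close>

lemma translation_invariant_measure_eq_lborel:
  fixes \<mu> :: "'a::euclidean_space measure"
  assumes sets: "sets \<mu> = sets borel"
    and finite: "\<And>r. emeasure \<mu> (cball 0 r) < \<infinity>" and nz: "emeasure \<mu> UNIV \<noteq> 0"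
    and inv: "\<And>h v. h \<in> borel_measurable borel \<Longrightarrow> (\<integral>\<^sup>+x. h (v + x) \<partial>\<mu>) = (\<integral>\<^sup>+x. h x \<partial>\<mu>)"
  obtains c where "0 < c"
    "\<And>h. h \<in> borel_measurable borel \<Longrightarrow> (\<integral>\<^sup>+x. h x \<partial>\<mu>) = ennreal c * (\<integral>\<^sup>+x. h x \<partial>lborel)"
proof -
  have space: "space \<mu> = UNIV"
    using sets_eq_imp_space_eq[OF sets] by simp
  have sf: "sigma_finite_measure \<mu>"
  proof
    have "(\<Union>n::nat. cball (0::'a) (real n)) = UNIV"
      using real_arch_simple by auto
    then show "\<exists>A. countable A \<and> A \<subseteq> sets \<mu> \<and> \<Union> A = space \<mu> \<and> (\<forall>a\<in>A. emeasure \<mu> a \<noteq> \<infinity>)"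
      using finite by (intro exI[of _ "range (\<lambda>n::nat. cball 0 (real n))"]) (auto simp: sets space less_top[symmetric])
  qed
  have invl: "(\<integral>\<^sup>+x. h (v + x) \<partial>lborel) = (\<integral>\<^sup>+x. h x \<partial>lborel)"
    if "h \<in> borel_measurable borel" for h and v :: 'a
    using that by (subst (2) lborel_distr_plus[of v, symmetric]) (simp add: nn_integral_distr)
  let ?m = "emeasure \<mu> (cball 0 1)" and ?l = "emeasure lborel (cball 0 1 :: 'a set)"
  have ml_eq: "(\<integral>\<^sup>+x. h x \<partial>\<mu>) * ?l = (\<integral>\<^sup>+x. h x \<partial>lborel) * ?m" if "h \<in> borel_measurable borel" for h
  proof -
    have "(\<integral>\<^sup>+x. h x \<partial>\<mu>) * (\<integral>\<^sup>+x. indicator (cball 0 1 :: 'a set) x \<partial>lborel) =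
        (\<integral>\<^sup>+x. h x \<partial>lborel) * (\<integral>\<^sup>+x. indicator (cball 0 1) (- x) \<partial>\<mu>)"
      by (rule translation_invariant_measure_unique[where g = "indicator (cball 0 1)"])
        (simp_all add: sets sf sigma_finite_lborel inv invl that borel_measurable_indicator)
    moreover have "(\<lambda>x::'a. indicator (cball 0 1) (- x) :: ennreal) = indicator (cball 0 1)"
      by (auto simp: indicator_def)
    ultimately show ?thesis by (simp add: sets)
  qed
  have l: "?l \<noteq> 0"
    using content_cball_pos[of 1 "0::'a"] by (intro notI) (simp add: measure_def)
  \<comment> \<open>With the constant integrand 1, a null ball would force the whole space to be
    null.\<close>
  have "?m \<noteq> 0"
  proof
    assume "?m = 0"
    with ml_eq[of "\<lambda>_. 1"] l nz show False by (simp add: space)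
  qed
  moreover have "?l < \<infinity>"
    by (rule emeasure_bounded_finite) simp
  ultimately obtain m l where ml: "?m = ennreal m" "?l = ennreal l" "0 < m" "0 < l"
    using finite[of 1] l by (cases ?m; cases ?l) (auto simp: less_le)
  show thesis
  proof (rule that[of "m / l"])
    show "0 < m / l" using ml by simp
    fix h :: "'a \<Rightarrow> ennreal" assume h: "h \<in> borel_measurable borel"
    have "(\<integral>\<^sup>+x. h x \<partial>\<mu>) = (\<integral>\<^sup>+x. h x \<partial>\<mu>) * (ennreal l * ennreal (1 / l))"
      using ml by (simp add: ennreal_mult[symmetric])
    also have "\<dots> = (\<integral>\<^sup>+x. h x \<partial>lborel) * (ennreal m * ennreal (1 / l))"
      using ml_eq[OF h] ml by (simp add: mult.assoc[symmetric])
    also have "\<dots> = ennreal (m / l) * (\<integral>\<^sup>+x. h x \<partial>lborel)"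
      using ml by (simp add: ennreal_mult[symmetric] mult.commute)
    finally show "(\<integral>\<^sup>+x. h x \<partial>\<mu>) = ennreal (m / l) * (\<integral>\<^sup>+x. h x \<partial>lborel)" .
  qed
qed

text \<open>The basis behind \<open>subspace_lborel UNIV\<close> is an arbitrary choice, so the
  comparison goes through translation invariance. The positive factor is left unspecified because it
  does not affect the sign of the final inequality.\<close>

lemma nn_integral_subspace_lborel_UNIV:
  obtains c where "0 < c" "\<And>h :: 'a::euclidean_space \<Rightarrow> ennreal. h \<in> borel_measurable borel \<Longrightarrow>
    (\<integral>\<^sup>+x. h x \<partial>subspace_lborel UNIV) = ennreal c * (\<integral>\<^sup>+x. h x \<partial>lborel)"
proof (rule translation_invariant_measure_eq_lborel[of "subspace_lborel (UNIV :: 'a set)"])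
  let ?P = "\<Pi>\<^sub>M b\<in>some_onb (UNIV :: 'a set). (lborel :: real measure)"
  interpret product_sigma_finite "\<lambda>_::'a. lborel :: real measure" ..
  have "emeasure (subspace_lborel (UNIV :: 'a set)) UNIV = emeasure ?P (\<Pi>\<^sub>E b\<in>some_onb UNIV. UNIV)"
    by (subst emeasure_subspace_lborel) (simp_all add: space_PiM)
  also have "\<dots> \<noteq> 0"
    using finite_some_onb[OF subspace_UNIV] by (subst emeasure_PiM) auto
  finally show "emeasure (subspace_lborel (UNIV :: 'a set)) UNIV \<noteq> 0" .
  show "(\<integral>\<^sup>+x. h (v + x) \<partial>subspace_lborel UNIV) = (\<integral>\<^sup>+x. h x \<partial>subspace_lborel UNIV)"
    if "h \<in> borel_measurable borel" for h and v :: 'a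
    using nn_integral_subspace_lborel_affine[OF subspace_UNIV that, of 1 v] by simp
qed (use that emeasure_subspace_lborel_cball[OF subspace_UNIV] in auto)

text \<open>The image of \<open>lborel\<close> under \<open>T\<close> is translation invariant
  because an injective endomorphism is onto, and finite on balls because \<open>T\<close> is bounded
  below.\<close>

lemma nn_integral_lborel_linear:
  fixes T :: "'a::euclidean_space \<Rightarrow> 'a"
  assumes T: "linear T" "inj T"
  obtains c where "0 < c" "\<And>h. h \<in> borel_measurable borel \<Longrightarrow>
    (\<integral>\<^sup>+x. h (T x) \<partial>lborel) = ennreal c * (\<integral>\<^sup>+x. h x \<partial>lborel)"
proof -
  let ?\<mu> = "distr lborel borel T"
  have [measurable]: "T \<in> borel_measurable borel"
    using T(1) by (intro borel_measurable_continuous_onI linear_continuous_on linear_conv_bounded_linear[THEN iffD1])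
  have int: "(\<integral>\<^sup>+x. h x \<partial>?\<mu>) = (\<integral>\<^sup>+x. h (T x) \<partial>lborel)" if "h \<in> borel_measurable borel" for h
    using that by (simp add: nn_integral_distr)
  obtain B where B: "B > 0" "\<And>x. B * norm x \<le> norm (T x)"
    using linear_inj_bounded_below_pos[OF T] by blast
  show thesis
  proof (rule translation_invariant_measure_eq_lborel[of ?\<mu>])
    show "emeasure ?\<mu> (cball 0 r) < \<infinity>" for r
    proof -
      have "norm x \<le> r / B" if "norm (T x) \<le> r" for x
        using B(2)[of x] that B(1) by (simp add: pos_le_divide_eq mult.commute)
      then have "T -` cball 0 r \<subseteq> cball 0 (r / B)"
        by auto
      then have "emeasure ?\<mu> (cball 0 r) \<le> emeasure lborel (cball 0 (r / B) :: 'a set)"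
        by (subst emeasure_distr) (auto intro: emeasure_mono)
      also have "\<dots> < \<infinity>"
        by (rule emeasure_bounded_finite) simp
      finally show ?thesis .
    qed
    show "(\<integral>\<^sup>+x. h (v + x) \<partial>?\<mu>) = (\<integral>\<^sup>+x. h x \<partial>?\<mu>)" if [measurable]: "h \<in> borel_measurable borel" for h v
    proof -
      obtain u where u: "T u = v"
        using T linear_injective_imp_surjective by (metis surjD)
      have "(\<integral>\<^sup>+x. h x \<partial>?\<mu>) = (\<integral>\<^sup>+x. h (T x) \<partial>distr lborel borel ((+) u))"
        by (simp add: int lborel_distr_plus)
      also have "\<dots> = (\<integral>\<^sup>+x. h (v + x) \<partial>?\<mu>)"
        by (simp add: int nn_integral_distr linear_add[OF T(1)] u)
      finally show ?thesis by simp
    qed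
    show "emeasure ?\<mu> UNIV \<noteq> 0"
      by (subst emeasure_distr) simp_all
  qed (use that int in auto)
qed

section \<open>Gaussian test functions\<close>

text \<open>Scaling \<open>r\<close> by \<open>b\<close> reduces this to the integral defining
  \<open>Gamma (real (Suc k))\<close>.\<close>

lemma integrable_power_exp:
  fixes b :: real
  assumes "0 < b"
  shows "integrable lborel (\<lambda>r. r ^ k * exp (- (b * r)) * indicator {0<..} r)"
proof -
  have "integrable lborel (\<lambda>r::real. r ^ k * exp (- r) * indicator {0<..} r)"
  proof (rule integrableI_nonneg)
    have "(\<integral>\<^sup>+r. ennreal (r ^ k * exp (- r) * indicator {0<..} r) \<partial>lborel) \<le>
        (\<integral>\<^sup>+r. ennreal (indicator {0..} r * r powr (real (Suc k) - 1) / exp r) \<partial>lborel)"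
      by (intro nn_integral_mono) (auto simp: powr_realpow exp_minus divide_inverse split: split_indicator)
    also have "\<dots> = ennreal (Gamma (real (Suc k)))"
      by (intro Gamma_conv_nn_integral_real[symmetric]) simp
    finally show "(\<integral>\<^sup>+r. ennreal (r ^ k * exp (- r) * indicator {0<..} r) \<partial>lborel) < \<infinity>"
      by (simp add: le_less_trans)
  qed (auto simp: indicator_def)
  from lborel_integrable_real_affine[OF this, of b 0] assms
  have "integrable lborel (\<lambda>r. (1 / b ^ k) * ((b * r) ^ k * exp (- (b * r)) * indicator {0<..} (b * r)))"
    by (intro integrable_mult_right) simp
  also have "(\<lambda>r. (1 / b ^ k) * ((b * r) ^ k * exp (- (b * r)) * indicator {0<..} (b * r))) =
      (\<lambda>r. r ^ k * exp (- (b * r)) * indicator {0<..} r)"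
    using assms by (auto simp: power_mult_distrib zero_less_mult_iff indicator_def)
  finally show ?thesis .
qed

text \<open>The linear map allows anisotropic Gaussians: \<open>M\<close> will be an inverse of
  \<open>T \<epsilon>\<close>, which flattens the Gaussian onto the hyperplane \<open>H\<close> as
  \<open>\<epsilon>\<close> tends to 0.\<close>

definition gauss :: "('a::euclidean_space \<Rightarrow> 'a) \<Rightarrow> 'a \<Rightarrow> 'a \<Rightarrow> real" where
  "gauss M v x = exp (- (norm (M (x - v)))\<^sup>2)"

lemma gauss_pos [simp]: "0 < gauss M v x" "0 \<le> gauss M v x"
  by (simp_all add: gauss_def)

lemma continuous_on_gauss [continuous_intros]:
  assumes "linear M" "continuous_on S f"
  shows "continuous_on S (\<lambda>x. gauss M v (f x))"
proof -
  have "continuous_on S (\<lambda>x. M (f x - v))"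
    using assms(1) unfolding linear_conv_bounded_linear
    by (rule bounded_linear.continuous_on) (intro continuous_intros assms(2))
  then show ?thesis
    unfolding gauss_def by (intro continuous_intros)
qed

lemma borel_measurable_gauss:
  assumes "linear M"
  shows "gauss M v \<in> borel_measurable borel"
  using continuous_on_gauss[OF assms continuous_on_id, of UNIV v]
  by (intro borel_measurable_continuous_onI) simp

text \<open>The weight \<open>r ^ k\<close> is the polar weight in dimension \<open>Suc k\<close>,
  that of a hyperplane when \<open>DIM('a) = Suc (Suc k)\<close>. The spherical Radon transform of
  this function is then the integral of the Gaussian over a hyperplane.\<close>

definition gauss_radial :: "('a::euclidean_space \<Rightarrow> 'a) \<Rightarrow> nat \<Rightarrow> 'a \<Rightarrow> 'a \<Rightarrow> real" where
  "gauss_radial M k v \<theta> = (\<integral>r. r ^ k * gauss M v (r *\<^sub>R \<theta>) * indicator {0<..} r \<partial>lborel)"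

text \<open>Dominated convergence needs a majorant independent of the direction. Since
  \<open>M\<close> is bounded below, the inequality \<open>y - 1 \<le> y\<^sup>2\<close> trades the
  Gaussian for an exponential in \<open>r\<close>.\<close>

lemma gauss_radial_bound:
  fixes M :: "'a::euclidean_space \<Rightarrow> 'a"
  assumes M: "linear M" "inj M"
  obtains w where "integrable lborel w"
    "\<And>r \<theta>. norm \<theta> = 1 \<Longrightarrow> r ^ k * gauss M v (r *\<^sub>R \<theta>) * indicator {0<..} r \<le> w r"
proof -
  obtain B where B: "B > 0" "\<And>x. B * norm x \<le> norm (M x)"
    using linear_inj_bounded_below_pos[OF M] by blast
  let ?C = "exp (1 + norm (M v))"
  show thesis
  proof (rule that)
    show "integrable lborel (\<lambda>r. ?C * (r ^ k * exp (- (B * r)) * indicator {0<..} r))"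
      by (intro integrable_mult_right integrable_power_exp B)
    fix r :: real and \<theta> :: 'a assume \<theta>: "norm \<theta> = 1"
    have "gauss M v (r *\<^sub>R \<theta>) \<le> ?C * exp (- (B * r))" if "r > 0"
    proof -
      have "B * r \<le> norm (M (r *\<^sub>R \<theta>))"
        using B(2)[of "r *\<^sub>R \<theta>"] \<theta> that by simp
      also have "\<dots> = norm (M (r *\<^sub>R \<theta> - v) + M v)"
        by (simp add: linear_diff[OF M(1)])
      also have "\<dots> \<le> norm (M (r *\<^sub>R \<theta> - v)) + norm (M v)"
        by (rule norm_triangle_ineq)
      finally have 1: "B * r - norm (M v) \<le> norm (M (r *\<^sub>R \<theta> - v))" by simp
      have 2: "y - 1 \<le> y\<^sup>2" for y :: real
        using zero_le_power2[of "y - 1/2"] by (simp add: power2_eq_square algebra_simps)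
      have "- (norm (M (r *\<^sub>R \<theta> - v)))\<^sup>2 \<le> 1 + norm (M v) + - (B * r)"
        using 1 2[of "norm (M (r *\<^sub>R \<theta> - v))"] by linarith
      then show ?thesis
        unfolding gauss_def exp_add[symmetric] by simp
    qed
    then have "r ^ k * gauss M v (r *\<^sub>R \<theta>) \<le> r ^ k * (?C * exp (- (B * r)))" if "r > 0"
      using that by (intro mult_left_mono) auto
    then show "r ^ k * gauss M v (r *\<^sub>R \<theta>) * indicator {0<..} r \<le> ?C * (r ^ k * exp (- (B * r)) * indicator {0<..} r)"
      by (auto simp: indicator_def ac_simps)
  qed
qed

lemma measurable_gauss_radial_integrand:
  assumes "linear M"
  shows "(\<lambda>r. r ^ k * gauss M v (r *\<^sub>R \<theta>) * indicator {0<..} r) \<in> borel_measurable lborel"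
proof -
  note [measurable] = borel_measurable_gauss[OF assms]
  show ?thesis by measurable
qed

lemma integrable_gauss_radial:
  fixes M :: "'a::euclidean_space \<Rightarrow> 'a"
  assumes M: "linear M" "inj M" and \<theta>: "norm \<theta> = 1"
  shows "integrable lborel (\<lambda>r. r ^ k * gauss M v (r *\<^sub>R \<theta>) * indicator {0<..} r)"
proof -
  obtain w where w: "integrable lborel w"
    "\<And>r \<theta>. norm \<theta> = 1 \<Longrightarrow> r ^ k * gauss M v (r *\<^sub>R \<theta>) * indicator {0<..} r \<le> w r"
    using gauss_radial_bound[OF M] by metis
  show ?thesis
  proof (rule Bochner_Integration.integrable_bound[OF w(1) measurable_gauss_radial_integrand[OF M(1)]], rule AE_I2)
    fix r
    show "norm (r ^ k * gauss M v (r *\<^sub>R \<theta>) * indicator {0<..} r) \<le> norm (w r)"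
      using w(2)[OF \<theta>, of r] by (auto simp: indicator_def abs_mult)
  qed
qed

lemma gauss_radial_nonneg: "0 \<le> gauss_radial M k v \<theta>"
  unfolding gauss_radial_def by (intro Bochner_Integration.integral_nonneg) (auto simp: indicator_def)

lemma ennreal_gauss_radial:
  fixes M :: "'a::euclidean_space \<Rightarrow> 'a"
  assumes M: "linear M" "inj M" and \<theta>: "norm \<theta> = 1"
  shows "ennreal (gauss_radial M k v \<theta>) =
    (\<integral>\<^sup>+r. ennreal (r ^ k) * ennreal (gauss M v (r *\<^sub>R \<theta>)) * indicator {0<..} r \<partial>lborel)"
  unfolding gauss_radial_def
  by (subst nn_integral_eq_integral[symmetric, OF integrable_gauss_radial[OF M \<theta>]])
    (auto simp: ennreal_mult indicator_def intro!: nn_integral_cong)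

text \<open>Test functions in the definition of an intersection body must be continuous on the
  sphere; the uniform majorant gives this by dominated convergence along sequences.\<close>

lemma continuous_on_gauss_radial:
  fixes M :: "'a::euclidean_space \<Rightarrow> 'a"
  assumes M: "linear M" "inj M"
  shows "continuous_on (sphere 0 1) (gauss_radial M k v)"
  unfolding continuous_on_sequentially o_def
proof (intro allI ballI impI)
  fix X :: "nat \<Rightarrow> 'a" and \<theta> assume \<theta>: "\<theta> \<in> sphere 0 1" and X: "(\<forall>n. X n \<in> sphere 0 1) \<and> X \<longlonglongrightarrow> \<theta>"
  obtain w where w: "integrable lborel w"
    "\<And>r \<theta>. norm \<theta> = 1 \<Longrightarrow> r ^ k * gauss M v (r *\<^sub>R \<theta>) * indicator {0<..} r \<le> w r"
    using gauss_radial_bound[OF M] by metis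
  show "(\<lambda>n. gauss_radial M k v (X n)) \<longlonglongrightarrow> gauss_radial M k v \<theta>"
    unfolding gauss_radial_def
  proof (rule integral_dominated_convergence[OF _ _ w(1)])
    show "AE r in lborel. (\<lambda>n. r ^ k * gauss M v (r *\<^sub>R X n) * indicator {0<..} r) \<longlonglongrightarrow>
        r ^ k * gauss M v (r *\<^sub>R \<theta>) * indicator {0<..} r"
    proof (rule AE_I2)
      fix r :: real
      have "continuous_on UNIV (\<lambda>x. r ^ k * gauss M v (r *\<^sub>R x) * indicator {0<..} r)"
        using M by (intro continuous_intros)
      then show "(\<lambda>n. r ^ k * gauss M v (r *\<^sub>R X n) * indicator {0<..} r) \<longlonglongrightarrow>
          r ^ k * gauss M v (r *\<^sub>R \<theta>) * indicator {0<..} r"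
        by (rule continuous_on_tendsto_compose) (use X in auto)
    qed
    show "AE r in lborel. norm (r ^ k * gauss M v (r *\<^sub>R X n) * indicator {0<..} r) \<le> w r" for n
    proof (rule AE_I2)
      fix r
      show "norm (r ^ k * gauss M v (r *\<^sub>R X n) * indicator {0<..} r) \<le> w r"
        using w(2)[of "X n" r] X by (auto simp: indicator_def abs_mult)
    qed
  qed (use measurable_gauss_radial_integrand[OF M(1)] in auto)
qed

lemma integrable_sphere_measure:
  fixes V :: "'a::euclidean_space set" and g :: "'a \<Rightarrow> real"
  assumes V: "subspace V" and g: "continuous_on (sphere 0 1) g"
  shows "integrable (sphere_measure V) g"
proof -
  interpret finite_measure "sphere_measure V"
    by (rule finite_sphere_measure[OF V])
  obtain C where C: "\<forall>y\<in>g ` sphere 0 1. norm y \<le> C"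
    using compact_imp_bounded[OF compact_continuous_image[OF g compact_sphere]]
    unfolding bounded_iff by blast
  have "g \<in> borel_measurable (restrict_space borel (V \<inter> sphere 0 1))"
    using continuous_on_subset[OF g] by (intro borel_measurable_continuous_on_restrict) auto
  then have "g \<in> borel_measurable (sphere_measure V)"
    by (simp cong: measurable_cong_sets add: sets_sphere_measure)
  then show ?thesis
    using C by (intro integrable_const_bound[of _ C] AE_I2) (auto simp: space_sphere_measure)
qed

text \<open>Splitting \<open>v\<close> into a part in \<open>V\<close> and a part whose image under \<open>M\<close> is orthogonal to \<open>M ` V\<close>,
  the former is absorbed by translation invariance.\<close>

lemma nn_integral_gauss_subspace:
  fixes M :: "'a::euclidean_space \<Rightarrow> 'a"
  assumes V: "subspace V" and M: "linear M"
  obtains q where "0 \<le> q" "\<And>j. (\<integral>\<^sup>+x. ennreal (gauss M (real j *\<^sub>R v) x) \<partial>subspace_lborel V) =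
    ennreal (q ^ j\<^sup>2) * (\<integral>\<^sup>+x. ennreal (gauss M 0 x) \<partial>subspace_lborel V)"
proof -
  have MV: "span (M ` V) = M ` V"
    using linear_subspace_image[OF M V] by (rule span_eq_iff[THEN iffD2])
  obtain y z where yz: "y \<in> M ` V" "\<And>w. w \<in> M ` V \<Longrightarrow> orthogonal z w" "M v = y + z"
    using orthogonal_subspace_decomp_exists[of "M ` V" "M v"] unfolding MV by metis
  then obtain p where p: "p \<in> V" "M v = M p + z" by auto
  show thesis
  proof (rule that)
    \<comment> \<open>After translation by \<open>real j *\<^sub>R p\<close> only the orthogonal
      part \<open>real j *\<^sub>R z\<close> of the shift is left, whose squared norm produces the
      exponent \<open>j\<^sup>2\<close>.\<close>
    show "0 \<le> exp (- (norm z)\<^sup>2)" by simp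
    fix j :: nat
    have "(\<integral>\<^sup>+x. ennreal (gauss M (real j *\<^sub>R v) x) \<partial>subspace_lborel V) =
        (\<integral>\<^sup>+x. ennreal (gauss M (real j *\<^sub>R v) (real j *\<^sub>R p + 1 *\<^sub>R x)) \<partial>subspace_lborel V)"
      using borel_measurable_gauss[OF M] subspace_scale[OF V p(1)]
      by (subst nn_integral_subspace_lborel_affine[OF V, where c = 1]) auto
    also have "\<dots> = (\<integral>\<^sup>+x. ennreal (exp (- (norm z)\<^sup>2) ^ j\<^sup>2) * ennreal (gauss M 0 x) \<partial>subspace_lborel V)"
      using AE_subspace_lborel[OF V]
    proof (intro nn_integral_cong_AE, eventually_elim)
      fix x assume x: "x \<in> V"
      have "M (real j *\<^sub>R p + 1 *\<^sub>R x - real j *\<^sub>R v) = M x - real j *\<^sub>R z"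
        using p(2) by (simp add: linear_diff[OF M] linear_add[OF M] linear_scale[OF M] scaleR_add_right)
      moreover have "(norm (M x - real j *\<^sub>R z))\<^sup>2 = (norm (M x))\<^sup>2 + (real j)\<^sup>2 * (norm z)\<^sup>2"
        using yz(2)[of "M x"] x
        by (simp add: orthogonal_def power2_norm_eq_inner inner_diff_left inner_diff_right
            inner_commute) (simp add: power2_eq_square)
      ultimately have "gauss M (real j *\<^sub>R v) (real j *\<^sub>R p + 1 *\<^sub>R x) = exp (- (norm z)\<^sup>2) ^ j\<^sup>2 * gauss M 0 x"
        by (simp add: gauss_def exp_of_nat_mult[symmetric] exp_add[symmetric])
      then show "ennreal (gauss M (real j *\<^sub>R v) (real j *\<^sub>R p + 1 *\<^sub>R x)) =
          ennreal (exp (- (norm z)\<^sup>2) ^ j\<^sup>2) * ennreal (gauss M 0 x)"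
        by (simp add: ennreal_mult)
    qed
    also have "\<dots> = ennreal (exp (- (norm z)\<^sup>2) ^ j\<^sup>2) * (\<integral>\<^sup>+x. ennreal (gauss M 0 x) \<partial>subspace_lborel V)"
      using borel_measurable_gauss[OF M] by (intro nn_integral_cmult) auto
    finally show "(\<integral>\<^sup>+x. ennreal (gauss M (real j *\<^sub>R v) x) \<partial>subspace_lborel V) = \<dots>" .
  qed
qed

text \<open>If \<open>D v\<close> is the difference between the values for 0 and for
  \<open>v\<close>, this combination is \<open>4 * D v - D (2 *\<^sub>R v)\<close>; it is the source
  of the doubling inequality.\<close>

definition gauss_test :: "('a::euclidean_space \<Rightarrow> 'a) \<Rightarrow> nat \<Rightarrow> 'a \<Rightarrow> 'a \<Rightarrow> real" where
  "gauss_test M k v \<theta> = 3 * gauss_radial M k 0 \<theta> - 4 * gauss_radial M k v \<theta> + gauss_radial M k (2 *\<^sub>R v) \<theta>"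

text \<open>Polar coordinates in the hyperplane orthogonal to \<open>\<xi>\<close> turn the Radon
  transform into Gaussian integrals over it, and the shifts by \<open>v\<close> and
  \<open>2 *\<^sub>R v\<close> multiply these by \<open>q\<close> and \<open>q ^ 4\<close>.\<close>

lemma spherical_radon_gauss_test_nonneg:
  fixes M :: "'a::euclidean_space \<Rightarrow> 'a"
  assumes M: "linear M" "inj M" and dim: "DIM('a) = Suc (Suc k)" and \<xi>: "norm \<xi> = 1"
  shows "0 \<le> spherical_radon (gauss_test M k v) \<xi>"
proof -
  define V where "V = {x. \<xi> \<bullet> x = 0}"
  have "\<xi> \<noteq> 0" using \<xi> by auto
  then have V: "subspace V" "dim V = Suc k"
    using dim \<xi> dim_hyperplane[of \<xi>] unfolding V_def by (auto simp: subspace_hyperplane)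
  let ?G = "\<lambda>u. \<integral>\<theta>. gauss_radial M k u \<theta> \<partial>sphere_measure V"
  have int: "integrable (sphere_measure V) (gauss_radial M k u)" for u
    by (intro integrable_sphere_measure V continuous_on_gauss_radial M)
  have G0: "0 \<le> ?G u" for u
    by (intro Bochner_Integration.integral_nonneg gauss_radial_nonneg)
  have G: "ennreal (?G u) = (\<integral>\<^sup>+x. ennreal (gauss M u x) \<partial>subspace_lborel V)" for u
  proof -
    have "ennreal (?G u) = (\<integral>\<^sup>+\<theta>. ennreal (gauss_radial M k u \<theta>) \<partial>sphere_measure V)"
      by (intro nn_integral_eq_integral[symmetric] int) (simp add: gauss_radial_nonneg)
    also have "\<dots> = (\<integral>\<^sup>+\<theta>. (\<integral>\<^sup>+r. ennreal (r ^ k) * ennreal (gauss M u (r *\<^sub>R \<theta>)) * indicator {0<..} r \<partial>lborel) \<partial>sphere_measure V)"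
      by (intro nn_integral_cong ennreal_gauss_radial M) (simp add: space_sphere_measure)
    also have "\<dots> = (\<integral>\<^sup>+x. ennreal (gauss M u x) \<partial>subspace_lborel V)"
      using borel_measurable_gauss[OF M(1)] by (intro polar_coordinates V) auto
    finally show ?thesis .
  qed
  obtain q where q: "0 \<le> q" "\<And>j. ennreal (?G (real j *\<^sub>R v)) = ennreal (q ^ j\<^sup>2) * ennreal (?G 0)"
    unfolding G using nn_integral_gauss_subspace[OF V(1) M(1), of v] by metis
  have q': "?G (real j *\<^sub>R v) = q ^ j\<^sup>2 * ?G 0" for j
    using q(2)[of j] G0 q(1) by (simp add: ennreal_mult[symmetric])
  have "spherical_radon (gauss_test M k v) \<xi> = 3 * ?G 0 - 4 * ?G v + ?G (2 *\<^sub>R v)"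
    unfolding spherical_radon_def gauss_test_def V_def[symmetric] using int by simp
  also have "\<dots> = (3 - 4 * q + q ^ 4) * ?G 0"
    using q'[of 1] q'[of 2] by (simp add: algebra_simps)
  \<comment> \<open>The double root at \<open>q = 1\<close> prevents a change of sign on
    \<open>q \<ge> 0\<close>.\<close>
  also have "3 - 4 * q + q ^ 4 = (1 - q)\<^sup>2 * (3 + 2 * q + q\<^sup>2)"
    by (simp add: power2_eq_square power4_eq_xxxx algebra_simps)
  also have "0 \<le> (1 - q)\<^sup>2 * (3 + 2 * q + q\<^sup>2) * ?G 0"
    using q(1) G0 by (intro mult_nonneg_nonneg) auto
  finally show ?thesis .
qed

section \<open>Radial functions off the unit sphere\<close>

lemma radial_eqI:
  assumes "a *\<^sub>R x \<in> K" "\<And>b. b *\<^sub>R x \<in> K \<Longrightarrow> b \<le> a"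
  shows "radial K x = a"
  unfolding radial_def using assms by (intro Greatest_equality) auto

text \<open>Compactness makes the greatest scalar an attained maximum for every nonzero vector, so
  \<open>radial K\<close> can be used as a function of degree -1 on the whole punctured
  space.\<close>

lemma
  fixes K :: "'a::euclidean_space set"
  assumes K: "compact K" "0 \<in> K" and x: "x \<noteq> 0"
  shows radial_mem: "radial K x *\<^sub>R x \<in> K"
    and le_radial: "a *\<^sub>R x \<in> K \<Longrightarrow> a \<le> radial K x"
proof -
  let ?S = "{a. a *\<^sub>R x \<in> K}"
  obtain R where R: "\<And>x. x \<in> K \<Longrightarrow> norm x \<le> R"
    using compact_imp_bounded[OF K(1)] bounded_iff by metis
  have "closed ((\<lambda>a. a *\<^sub>R x) -` K)"
    by (intro closed_vimage compact_imp_closed K continuous_intros)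
  moreover have "bounded ?S"
    unfolding bounded_iff
  proof (intro exI ballI)
    fix a assume "a \<in> ?S"
    then show "norm a \<le> R / norm x"
      using R[of "a *\<^sub>R x"] x by (simp add: field_simps)
  qed
  ultimately have "compact ?S" by (simp add: compact_eq_bounded_closed vimage_def)
  moreover have "?S \<noteq> {}" using K by (auto intro: exI[of _ 0])
  ultimately obtain m where m: "m \<in> ?S" "\<forall>a\<in>?S. a \<le> m"
    using compact_attains_sup by metis
  then have "radial K x = m"
    by (intro radial_eqI) auto
  then show "radial K x *\<^sub>R x \<in> K" "a *\<^sub>R x \<in> K \<Longrightarrow> a \<le> radial K x"
    using m by auto
qed

lemma radial_scale:
  fixes K :: "'a::euclidean_space set"
  assumes K: "compact K" "0 \<in> K" and x: "x \<noteq> 0" and c: "0 < c"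
  shows "radial K (c *\<^sub>R x) = radial K x / c"
proof (rule radial_eqI)
  show "(radial K x / c) *\<^sub>R c *\<^sub>R x \<in> K"
    using radial_mem[OF K x] c by simp
  show "b \<le> radial K x / c" if "b *\<^sub>R c *\<^sub>R x \<in> K" for b
    using le_radial[OF K x, of "b * c"] that c by (simp add: pos_le_divide_eq)
qed

lemma radial_nonneg:
  fixes K :: "'a::euclidean_space set"
  assumes "compact K" "0 \<in> K" "x \<noteq> 0"
  shows "0 \<le> radial K x"
  using le_radial[OF assms, of 0] assms(2) by simp

lemma star_bodyD:
  assumes "star_body K"
  shows "compact K" "0 \<in> K" "continuous_on (sphere 0 1) (radial K)"
  using assms interior_subset by (auto simp: star_body_def)

text \<open>Homogeneity reduces continuity away from the origin to continuity on the sphere. At the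
  origin every scalar qualifies, so \<open>GREATEST\<close> has an unspecified value there, but a
  single point does not harm measurability.\<close>

lemma borel_measurable_radial:
  fixes K :: "'a::euclidean_space set"
  assumes "star_body K"
  shows "radial K \<in> borel_measurable borel"
proof (rule borel_measurable_continuous_countable_exceptions[of "{0}"])
  note K = star_bodyD[OF assms]
  have "continuous_on (- {0}) (\<lambda>x. radial K (sgn x) / norm x)"
    by (intro continuous_intros continuous_on_compose2[OF K(3)]) (auto simp: norm_sgn split: if_splits)
  moreover have "radial K (sgn x) / norm x = radial K x" if "x \<noteq> 0" for x
    using radial_scale[OF K(1,2), of "sgn x" "norm x"] that by (simp add: sgn_div_norm)
  ultimately show "continuous_on (- {0}) (radial K)"
    by (subst continuous_on_cong[OF refl, of _ _ "\<lambda>x. radial K (sgn x) / norm x"]) auto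
qed auto

text \<open>Having degree -1, \<open>radial K\<close> absorbs one power of \<open>r\<close>: the
  polar weight \<open>r ^ Suc k\<close> of the whole space times
  \<open>radial K (r *\<^sub>R \<theta>)\<close> equals \<open>r ^ k\<close> times
  \<open>radial K \<theta>\<close>. Hence the same \<open>gauss_radial\<close> describes integrals
  over hyperplanes and the weighted integral over the space. The real-valued \<open>I\<close>
  carries the finiteness of the latter.\<close>

lemma intersection_body_gauss_inequality:
  fixes K :: "'a::euclidean_space set"
  assumes K: "intersection_body K" and dim: "DIM('a) = Suc (Suc k)"
    and M: "linear M" "inj M"
  obtains I where "\<And>u. 0 \<le> I u" "0 \<le> 3 * I 0 - 4 * I v + I (2 *\<^sub>R v)"
    "\<And>u. ennreal (I u) = (\<integral>\<^sup>+x. ennreal (radial K x * gauss M u x) \<partial>subspace_lborel UNIV)"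
proof -
  have star: "star_body K"
    using K by (simp add: intersection_body_def)
  note K' = star_bodyD[OF star]
  obtain \<mu> where \<mu>: "even_finite_sphere_measure \<mu>"
    "\<And>g. continuous_on (sphere 0 1) g \<Longrightarrow>
      (\<integral>\<xi>. radial K \<xi> * g \<xi> \<partial>sphere_measure UNIV) = (\<integral>\<xi>. spherical_radon g \<xi> \<partial>\<mu>)"
    using K by (auto simp: intersection_body_def)
  have space: "space \<mu> = sphere 0 1"
    using \<mu>(1) sets_eq_imp_space_eq[of \<mu> "restrict_space borel (sphere 0 1)"]
    by (simp add: even_finite_sphere_measure_def space_restrict_space)
  let ?I = "\<lambda>u. \<integral>\<theta>. radial K \<theta> * gauss_radial M k u \<theta> \<partial>sphere_measure UNIV"
  have int: "integrable (sphere_measure UNIV) (\<lambda>\<theta>. radial K \<theta> * gauss_radial M k u \<theta>)" for u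
    by (intro integrable_sphere_measure subspace_UNIV continuous_on_mult K'(3) continuous_on_gauss_radial M)
  have nn: "0 \<le> radial K \<theta> * gauss_radial M k u \<theta>" if "norm \<theta> = 1" for \<theta> u
  proof -
    have "\<theta> \<noteq> 0" using that by auto
    then show ?thesis
      by (intro mult_nonneg_nonneg radial_nonneg[OF K'(1,2)] gauss_radial_nonneg)
  qed
  show thesis
  proof (rule that)
    show "0 \<le> ?I u" for u
      by (rule Bochner_Integration.integral_nonneg) (simp add: nn space_sphere_measure)
    have "3 * ?I 0 - 4 * ?I v + ?I (2 *\<^sub>R v) = (\<integral>\<theta>. 3 * (radial K \<theta> * gauss_radial M k 0 \<theta>)
        - 4 * (radial K \<theta> * gauss_radial M k v \<theta>) + radial K \<theta> * gauss_radial M k (2 *\<^sub>R v) \<theta> \<partial>sphere_measure UNIV)"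
      using int by simp
    also have "\<dots> = (\<integral>\<theta>. radial K \<theta> * gauss_test M k v \<theta> \<partial>sphere_measure UNIV)"
      by (simp add: gauss_test_def algebra_simps)
    also have "\<dots> = (\<integral>\<xi>. spherical_radon (gauss_test M k v) \<xi> \<partial>\<mu>)"
      unfolding gauss_test_def by (intro \<mu>(2) continuous_intros continuous_on_gauss_radial M)
    also have "0 \<le> \<dots>"
      by (rule Bochner_Integration.integral_nonneg)
        (simp add: space spherical_radon_gauss_test_nonneg[OF M dim])
    finally show "0 \<le> 3 * ?I 0 - 4 * ?I v + ?I (2 *\<^sub>R v)" .
    fix u
    note [measurable] = borel_measurable_gauss[OF M(1)] borel_measurable_radial[OF star]
    have "ennreal (?I u) = (\<integral>\<^sup>+\<theta>. ennreal (radial K \<theta> * gauss_radial M k u \<theta>) \<partial>sphere_measure UNIV)"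
      by (intro nn_integral_eq_integral[symmetric] int AE_I2) (simp add: nn space_sphere_measure)
    also have "\<dots> = (\<integral>\<^sup>+\<theta>. (\<integral>\<^sup>+r. ennreal (r ^ Suc k) * ennreal (radial K (r *\<^sub>R \<theta>) * gauss M u (r *\<^sub>R \<theta>)) * indicator {0<..} r \<partial>lborel) \<partial>sphere_measure UNIV)"
    proof (rule nn_integral_cong)
      fix \<theta> :: 'a assume "\<theta> \<in> space (sphere_measure UNIV)"
      then have \<theta>: "norm \<theta> = 1" by (simp add: space_sphere_measure)
      then have \<theta>': "\<theta> \<noteq> 0" by auto
      have "ennreal (radial K \<theta> * gauss_radial M k u \<theta>) = ennreal (radial K \<theta>) * ennreal (gauss_radial M k u \<theta>)"
        using radial_nonneg[OF K'(1,2) \<theta>'] gauss_radial_nonneg by (intro ennreal_mult) auto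
      also have "\<dots> = (\<integral>\<^sup>+r. ennreal (radial K \<theta>) * (ennreal (r ^ k) * ennreal (gauss M u (r *\<^sub>R \<theta>)) * indicator {0<..} r) \<partial>lborel)"
        unfolding ennreal_gauss_radial[OF M \<theta>] by (subst nn_integral_cmult) auto
      also have "\<dots> = (\<integral>\<^sup>+r. ennreal (r ^ Suc k) * ennreal (radial K (r *\<^sub>R \<theta>) * gauss M u (r *\<^sub>R \<theta>)) * indicator {0<..} r \<partial>lborel)"
      proof (rule nn_integral_cong)
        fix r :: real
        show "ennreal (radial K \<theta>) * (ennreal (r ^ k) * ennreal (gauss M u (r *\<^sub>R \<theta>)) * indicator {0<..} r) =
            ennreal (r ^ Suc k) * ennreal (radial K (r *\<^sub>R \<theta>) * gauss M u (r *\<^sub>R \<theta>)) * indicator {0<..} r"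
          using radial_scale[OF K'(1,2) \<theta>', of r] radial_nonneg[OF K'(1,2) \<theta>']
          by (auto simp: indicator_def ennreal_mult[symmetric] ac_simps)
      qed
      finally show "ennreal (radial K \<theta> * gauss_radial M k u \<theta>) = \<dots>" .
    qed
    also have "\<dots> = (\<integral>\<^sup>+x. ennreal (radial K x * gauss M u x) \<partial>subspace_lborel UNIV)"
      by (intro polar_coordinates) (auto simp: dim)
    finally show "ennreal (?I u) = (\<integral>\<^sup>+x. ennreal (radial K x * gauss M u x) \<partial>subspace_lborel UNIV)" .
  qed
qed

section \<open>Cylinders\<close>

text \<open>Directness makes decompositions unique, so the symmetry of \<open>K\<close> passes to
  the segment, which must run from \<open>p\<close> to \<open>- p\<close>. The witnesses are
  \<open>a = p\<close> and \<open>H = span B\<close>.\<close>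

lemma segment_body_direct_sum_symmetric:
  fixes K :: "'a::euclidean_space set"
  assumes sum: "segment_body_direct_sum K A B" and sym: "origin_symmetric K" and ne: "K \<noteq> {}"
  obtains a H where "subspace H" "dim H = DIM('a) - 1" "a \<notin> H"
    "\<And>y t. y \<in> H \<Longrightarrow> y + t *\<^sub>R a \<in> K \<longleftrightarrow> y \<in> K \<and> \<bar>t\<bar> \<le> 1"
proof -
  have K: "K = {a + b |a b. a \<in> A \<and> b \<in> B}" and "dim (span A) = 1"
    and dimB: "dim (span B) = DIM('a) - 1" and disj: "span A \<inter> span B = {0}"
    using sum by (auto simp: segment_body_direct_sum_def)
  obtain p q where A: "A = closed_segment p q"
    using sum by (auto simp: segment_body_direct_sum_def)
  have unique: "x = x' \<and> y = y'"
    if "x + y = x' + y'" "x \<in> span A" "x' \<in> span A" "y \<in> span B" "y' \<in> span B" for x x' y y'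
  proof -
    have "x - x' = y' - y" using that(1) by (simp add: algebra_simps)
    moreover have "x - x' \<in> span A" "y' - y \<in> span B" using that by (auto intro: span_diff)
    ultimately have "x - x' \<in> {0}" unfolding disj[symmetric] by simp
    then show ?thesis using that(1) by simp
  qed
  obtain b where b: "b \<in> B" using ne K by auto
  have symA: "- x \<in> A" if x: "x \<in> A" for x
  proof -
    have "x + b \<in> K" using K x b by auto
    then have "- (x + b) \<in> K" using sym unfolding origin_symmetric_def by blast
    then obtain x' b' where "- (x + b) = x' + b'" "x' \<in> A" "b' \<in> B" using K by auto
    then show ?thesis
      using unique[of "- x" "- b" x' b'] x b by (auto simp: span_base span_neg)
  qed
  have "closed_segment (- p) (- q) = uminus ` A"
    unfolding A by (intro closed_segment_linear_image) (auto intro: linearI)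
  also have "\<dots> = A"
    using symA by force
  \<comment> \<open>Negation permutes the two endpoints. Fixing them would give
    \<open>p = q = 0\<close>, contrary to \<open>dim (span A) = 1\<close>, so it swaps them.\<close>
  finally have "{- p, - q} = {p, q}"
    unfolding A closed_segment_eq .
  moreover have "\<not> (p = 0 \<and> q = 0)"
    using \<open>dim (span A) = 1\<close> A by auto
  moreover have "x = 0" if "- x = x" for x :: 'a
    using that by (metis add.right_inverse scaleR_half_double scaleR_zero_right)
  ultimately have "q = - p \<and> p \<noteq> 0"
    by (metis doubleton_eq_iff minus_minus neg_equal_0_iff_equal)
  then have q: "q = - p" and p: "p \<noteq> 0"
    by auto
  have A_iff: "t *\<^sub>R p \<in> A \<longleftrightarrow> \<bar>t\<bar> \<le> 1" for t
  proof -
    have "t *\<^sub>R p \<in> A \<longleftrightarrow> (\<exists>u. 0 \<le> u \<and> u \<le> 1 \<and> t = 1 - u - u)"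
    proof -
      have "t *\<^sub>R p - ((1 - u) *\<^sub>R p + u *\<^sub>R (- p)) = (t - (1 - u - u)) *\<^sub>R p" for u
        by (simp add: scaleR_left_diff_distrib) (simp only: mult_2 scaleR_left_distrib)
      then have "t *\<^sub>R p = (1 - u) *\<^sub>R p + u *\<^sub>R (- p) \<longleftrightarrow> (t - (1 - u - u)) *\<^sub>R p = 0" for u
        by (metis right_minus_eq)
      then show ?thesis
        unfolding A q closed_segment_def using p by (simp, blast)
    qed
    also have "\<dots> \<longleftrightarrow> \<bar>t\<bar> \<le> 1"
    proof
      show "\<bar>t\<bar> \<le> 1 \<Longrightarrow> \<exists>u. 0 \<le> u \<and> u \<le> 1 \<and> t = 1 - u - u"
        by (intro exI[of _ "(1 - t) / 2"]) (auto simp: field_simps)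
    qed auto
    finally show ?thesis .
  qed
  have pA: "p \<in> A" using A_iff[of 1] by simp
  have K_iff: "y + t *\<^sub>R p \<in> K \<longleftrightarrow> y \<in> B \<and> \<bar>t\<bar> \<le> 1" if y: "y \<in> span B" for y t
  proof
    assume "y + t *\<^sub>R p \<in> K"
    then obtain x' b' where "y + t *\<^sub>R p = x' + b'" "x' \<in> A" "b' \<in> B" using K by auto
    then show "y \<in> B \<and> \<bar>t\<bar> \<le> 1"
      using unique[of "t *\<^sub>R p" y x' b'] y pA A_iff by (auto simp: span_base span_scale add.commute)
  next
    assume "y \<in> B \<and> \<bar>t\<bar> \<le> 1"
    then have "t *\<^sub>R p \<in> A" "y \<in> B"
      using A_iff by auto
    then show "y + t *\<^sub>R p \<in> K"
      unfolding K using add.commute by blast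
  qed
  show thesis
  proof (rule that)
    show "subspace (span B)" "dim (span B) = DIM('a) - 1" using dimB by auto
    show "p \<notin> span B" using p pA disj span_base by blast
    show "y + t *\<^sub>R p \<in> K \<longleftrightarrow> y \<in> K \<and> \<bar>t\<bar> \<le> 1" if "y \<in> span B" for y t
      using K_iff[OF that] K_iff[OF that, of 0] by auto
  qed
qed

section \<open>Power weights against a Gaussian, and the doubling argument\<close>

lemma nn_integral_powr_gauss_finite:
  fixes p :: real
  assumes "p > -1"
  shows "(\<integral>\<^sup>+x. ennreal (\<bar>x\<bar> powr p * exp (- x\<^sup>2)) \<partial>lborel) < \<infinity>"
proof -
  let ?h = "\<lambda>x. ennreal (\<bar>x\<bar> powr p * exp (- x\<^sup>2))"
  have "(\<integral>\<^sup>+x. ?h x * indicator {0..} x \<partial>lborel) \<le>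
      (\<integral>\<^sup>+x. ennreal (exp 1) * ennreal (indicator {0..} x * x powr ((p + 1) - 1) / exp x) \<partial>lborel)"
  proof (rule nn_integral_mono)
    fix x :: real
    have "x - 1 \<le> x\<^sup>2"
      using zero_le_power2[of "x - 1/2"] by (simp add: power2_eq_square algebra_simps)
    then have "exp (- x\<^sup>2) \<le> exp 1 * exp (- x)"
      unfolding exp_add[symmetric] by simp
    then have "x powr p * exp (- x\<^sup>2) \<le> x powr p * (exp 1 * exp (- x))"
      by (intro mult_left_mono) auto
    then show "?h x * indicator {0..} x \<le> ennreal (exp 1) * ennreal (indicator {0..} x * x powr ((p + 1) - 1) / exp x)"
      by (auto simp: indicator_def ennreal_mult[symmetric] exp_minus divide_inverse ac_simps intro!: ennreal_leI)
  qed
  also have "\<dots> = ennreal (exp 1) * ennreal (Gamma (p + 1))"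
    using assms by (subst Gamma_conv_nn_integral_real) (auto intro: nn_integral_cmult)
  also have "\<dots> < \<infinity>"
    by (simp add: ennreal_mult_less_top)
  finally have half: "(\<integral>\<^sup>+x. ?h x * indicator {0..} x \<partial>lborel) < \<infinity>" .
  have "(\<integral>\<^sup>+x. ?h x \<partial>lborel) \<le> (\<integral>\<^sup>+x. ?h x * indicator {0..} x + ?h (0 + (-1) * x) * indicator {0..} (0 + (-1) * x) \<partial>lborel)"
    by (intro nn_integral_mono) (auto simp: indicator_def)
  also have "\<dots> = (\<integral>\<^sup>+x. ?h x * indicator {0..} x \<partial>lborel) + (\<integral>\<^sup>+x. ?h (0 + (-1) * x) * indicator {0..} (0 + (-1) * x) \<partial>lborel)"
    by (intro nn_integral_add) auto
  also have "(\<integral>\<^sup>+x. ?h (0 + (-1) * x) * indicator {0..} (0 + (-1) * x) \<partial>lborel) = (\<integral>\<^sup>+x. ?h x * indicator {0..} x \<partial>lborel)"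
    by (subst nn_integral_real_affine[of "\<lambda>x. ?h x * indicator {0..} x" "-1" 0]) auto
  finally show ?thesis
    using half by (simp add: le_less_trans)
qed

text \<open>The Gaussian factors over the coordinates, so the integral is a product of
  one-dimensional ones.\<close>

lemma integrable_prod_powr_gauss:
  fixes p :: "'a::euclidean_space \<Rightarrow> real"
  assumes "\<And>b. b \<in> Basis \<Longrightarrow> p b > -1"
  shows "integrable lborel (\<lambda>w. (\<Prod>b\<in>Basis. \<bar>w \<bullet> b\<bar> powr p b) * exp (- (norm w)\<^sup>2))"
proof (rule integrableI_nonneg)
  have eq: "(\<Prod>b\<in>Basis. \<bar>w \<bullet> b\<bar> powr p b) * exp (- (norm w)\<^sup>2) = (\<Prod>b\<in>Basis. \<bar>w \<bullet> b\<bar> powr p b * exp (- (w \<bullet> b)\<^sup>2))" for w :: 'a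
  proof -
    have "exp (- (norm w)\<^sup>2) = (\<Prod>b\<in>Basis. exp (- (w \<bullet> b)\<^sup>2))"
      by (subst power2_norm_eq_inner, subst euclidean_inner)
        (simp add: exp_sum[symmetric] sum_negf power2_eq_square)
    then show ?thesis by (simp add: prod.distrib)
  qed
  have "(\<integral>\<^sup>+w. ennreal ((\<Prod>b\<in>Basis. \<bar>w \<bullet> b\<bar> powr p b) * exp (- (norm w)\<^sup>2)) \<partial>lborel) =
      (\<integral>\<^sup>+w. (\<Prod>b\<in>Basis. ennreal (\<bar>w \<bullet> b\<bar> powr p b * exp (- (w \<bullet> b)\<^sup>2))) \<partial>(lborel :: 'a measure))"
    unfolding eq by (simp add: prod_ennreal)
  also have "\<dots> = (\<Prod>b\<in>Basis. \<integral>\<^sup>+x. ennreal (\<bar>x\<bar> powr p b * exp (- x\<^sup>2)) \<partial>lborel)"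
    by (rule nn_integral_lborel_prod) auto
  also have "\<dots> < \<infinity>"
    using nn_integral_powr_gauss_finite[OF assms] by (auto simp: less_top[symmetric] ennreal_prod_eq_top)
  finally show "(\<integral>\<^sup>+w. ennreal ((\<Prod>b\<in>Basis. \<bar>w \<bullet> b\<bar> powr p b) * exp (- (norm w)\<^sup>2)) \<partial>lborel) < \<infinity>" .
qed (auto intro!: AE_I2 mult_nonneg_nonneg prod_nonneg)

lemma AE_lborel_inner_nonzero: "AE w in lborel. \<forall>b\<in>Basis. w \<bullet> b \<noteq> (0::real)"
proof -
  have "AE w in lborel. w \<bullet> b \<noteq> 0" if "b \<in> Basis" for b :: 'a
  proof (rule AE_I')
    have "negligible {w. b \<bullet> w = 0}"
      using that by (intro negligible_hyperplane) auto
    then have "{w. b \<bullet> w = 0} \<in> null_sets lebesgue"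
      by (simp add: negligible_iff_null_sets)
    moreover have "{w. b \<bullet> w = 0} \<in> sets borel"
      by (intro borel_closed closed_hyperplane)
    ultimately show "{w. b \<bullet> w = 0} \<in> null_sets lborel"
      by (simp add: null_sets_def)
  qed (auto simp: inner_commute)
  then show ?thesis
    by (simp add: AE_finite_all)
qed

text \<open>Iterating down to \<open>s / 2 ^ m\<close> costs \<open>4 ^ m\<close>, while the power
  bound gains \<open>(2 powr (5/2)) ^ m\<close>. Any exponent above 2 would make the ratio less than
  1.\<close>

lemma doubling_eq_zero:
  fixes H :: "real \<Rightarrow> real"
  assumes double: "\<And>s. 0 < s \<Longrightarrow> H (2 * s) \<le> 4 * H s"
    and nonneg: "\<And>s. 0 < s \<Longrightarrow> 0 \<le> H s" and bound: "\<And>s. 0 < s \<Longrightarrow> H s \<le> C * s powr (5/2)"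
    and s: "0 < s"
  shows "H s = 0"
proof -
  let ?r = "4 / 2 powr (5/2) :: real"
  have "H s \<le> C * s powr (5/2) * ?r ^ m" for m
  proof -
    have "H s \<le> 4 ^ m * H (s / 2 ^ m)"
    proof (induction m)
      case (Suc m)
      have "4 ^ m * H (s / 2 ^ m) \<le> 4 ^ m * (4 * H (s / 2 ^ Suc m))"
        using double[of "s / 2 ^ Suc m"] s by (intro mult_left_mono) auto
      then have "4 ^ m * H (s / 2 ^ m) \<le> 4 ^ Suc m * H (s / 2 ^ Suc m)"
        by simp
      with Suc show ?case by (rule order_trans)
    qed simp
    also have "\<dots> \<le> 4 ^ m * (C * (s / 2 ^ m) powr (5/2))"
      using s by (intro mult_left_mono bound) auto
    also have "(s / 2 ^ m) powr (5/2) = s powr (5/2) / (2 powr (5/2)) ^ m"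
      using s by (simp add: powr_divide powr_power flip: powr_realpow) (simp add: powr_powr mult.commute)
    finally show ?thesis
      by (simp add: power_divide ac_simps)
  qed
  moreover have "?r < 1"
  proof -
    have "(2::real) powr 2 < 2 powr (5/2)" by (intro powr_less_mono) auto
    then show ?thesis by simp
  qed
  then have "(\<lambda>m. C * s powr (5/2) * ?r ^ m) \<longlonglongrightarrow> C * s powr (5/2) * 0"
    by (intro tendsto_intros LIMSEQ_power_zero) auto
  ultimately have "H s \<le> 0"
    by (intro LIMSEQ_le_const[of _ 0]) auto
  then show ?thesis using nonneg[OF s] by simp
qed

section \<open>Gaussian averages of the radial function of a cylinder\<close>

locale symmetric_cylinder =
  fixes K H :: "'a::euclidean_space set" and a e :: 'a and f :: "'a \<Rightarrow> 'a"
  assumes star: "star_body K" and subspace_H: "subspace H" and a: "a \<notin> H"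
    and mem_K_iff: "\<And>y t. y \<in> H \<Longrightarrow> y + t *\<^sub>R a \<in> K \<longleftrightarrow> y \<in> K \<and> \<bar>t\<bar> \<le> 1"
    and e: "e \<in> Basis" and f: "linear f"
    and f_mem: "\<And>w. w \<bullet> e = 0 \<Longrightarrow> f w \<in> H" and norm_f: "\<And>w. w \<bullet> e = 0 \<Longrightarrow> norm (f w) = norm w"
    and dim: "DIM('a) \<ge> 5"
begin

definition P :: "'a \<Rightarrow> 'a" where
  "P w = w - (w \<bullet> e) *\<^sub>R e"

text \<open>The gauge of \<open>K\<close> at the point of \<open>H\<close> with coordinates
  \<open>P w\<close>; for gauges the cylinder formula is a maximum. Where \<open>P w = 0\<close>, a
  null set, the value is unspecified.\<close>

definition q :: "'a \<Rightarrow> real" where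
  "q w = inverse (radial K (f (P w)))"

text \<open>The axis direction is shrunk by \<open>\<epsilon>\<close>, so the image of the standard
  Gaussian tends to a Gaussian measure carried by \<open>H\<close>.\<close>

definition T :: "real \<Rightarrow> 'a \<Rightarrow> 'a" where
  "T \<epsilon> w = f (P w) + (\<epsilon> * (w \<bullet> e)) *\<^sub>R a"

lemmas K = star_bodyD[OF star]

lemma linear_P: "linear P"
  unfolding P_def by (intro linearI) (auto simp: algebra_simps)

lemma P_e [simp]: "P w \<bullet> e = 0"
  using e by (simp add: P_def inner_diff_left)

lemma P_inner: "b \<in> Basis \<Longrightarrow> b \<noteq> e \<Longrightarrow> P w \<bullet> b = w \<bullet> b"
  using e by (simp add: P_def inner_diff_left inner_Basis)

lemma linear_fP: "linear (\<lambda>w. f (P w))"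
  using linear_compose[OF linear_P f] by (simp add: o_def)

lemma continuous_on_fP: "continuous_on S (\<lambda>w. f (P w))"
  using linear_fP by (intro linear_continuous_on) (simp add: linear_conv_bounded_linear)

lemma norm_fP: "norm (f (P w)) = norm (P w)"
  by (intro norm_f) simp

lemma linear_T: "linear (T \<epsilon>)"
  unfolding T_def
  by (intro linearI) (simp_all add: linear_add[OF linear_fP] linear_scale[OF linear_fP] algebra_simps)

lemma inj_T:
  assumes "\<epsilon> \<noteq> 0"
  shows "inj (T \<epsilon>)"
proof -
  have "w = 0" if w: "T \<epsilon> w = 0" for w
  proof -
    have "f (P w) \<in> H" by (intro f_mem) simp
    moreover have "(\<epsilon> * (w \<bullet> e)) *\<^sub>R a = - f (P w)"
      using w by (simp add: T_def add_eq_0_iff)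
    ultimately have aH: "(\<epsilon> * (w \<bullet> e)) *\<^sub>R a \<in> H"
      using subspace_neg[OF subspace_H] by simp
    have "\<epsilon> * (w \<bullet> e) = 0"
    proof (rule ccontr)
      assume nz: "\<epsilon> * (w \<bullet> e) \<noteq> 0"
      then have "a \<in> H"
        using subspace_scale[OF subspace_H aH, of "inverse (\<epsilon> * (w \<bullet> e))"]
        by (simp only: scaleR_scaleR left_inverse[OF nz] scaleR_one)
      with a show False ..
    qed
    then have we: "w \<bullet> e = 0"
      using assms by simp
    then have "norm (P w) = 0"
      using w norm_fP[of w] by (simp add: T_def)
    then show ?thesis using we by (simp add: P_def)
  qed
  then show ?thesis
    using linear_injective_0[OF linear_T] by blast
qed

lemma borel_measurable_q [measurable]: "q \<in> borel_measurable borel"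
proof -
  have [measurable]: "(\<lambda>w. f (P w)) \<in> borel_measurable borel"
    by (intro borel_measurable_continuous_onI continuous_on_fP)
  note [measurable] = borel_measurable_radial[OF star]
  show ?thesis unfolding q_def by measurable
qed

lemma radial_pos:
  assumes "x \<noteq> 0"
  shows "0 < radial K x"
proof -
  obtain r where r: "0 < r" "cball 0 r \<subseteq> K"
    using star mem_interior_cball[of 0 K] by (auto simp: star_body_def)
  have "(r / norm x) *\<^sub>R x \<in> K"
    using r assms by (intro subsetD[OF r(2)]) auto
  then have "r / norm x \<le> radial K x"
    by (rule le_radial[OF K(1,2) assms])
  moreover have "0 < r / norm x" using r assms by simp
  ultimately show ?thesis by linarith
qed

text \<open>A multiple \<open>b *\<^sub>R (y + t *\<^sub>R a)\<close> lies in \<open>K\<close> iff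
  \<open>b *\<^sub>R y \<in> K\<close> and \<open>\<bar>b * t\<bar> \<le> 1\<close>, so the gauge of
  the cylinder is the maximum of the gauges of its base and its axis.\<close>

lemma radial_cylinder:
  assumes y: "y \<in> H" "y \<noteq> 0"
  shows "radial K (y + t *\<^sub>R a) = inverse (max \<bar>t\<bar> (inverse (radial K y)))"
proof (rule radial_eqI)
  let ?m = "max \<bar>t\<bar> (inverse (radial K y))"
  have pos: "0 < radial K y" "0 < ?m"
    using radial_pos[OF y(2)] by (auto simp: less_max_iff_disj)
  have scale: "b *\<^sub>R (y + t *\<^sub>R a) \<in> K \<longleftrightarrow> b *\<^sub>R y \<in> K \<and> \<bar>b * t\<bar> \<le> 1" for b
    using mem_K_iff[of "b *\<^sub>R y" "b * t"] subspace_scale[OF subspace_H y(1)]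
    by (simp add: scaleR_add_right)
  have "inverse ?m \<le> inverse (inverse (radial K y))"
    using pos(1) by (intro le_imp_inverse_le) auto
  then have "inverse ?m \<le> radial K y"
    by simp
  then have "inverse ?m / radial K y \<in> {0..1}"
    using pos by (simp add: divide_le_eq)
  then have "(inverse ?m / radial K y) *\<^sub>R (radial K y *\<^sub>R y) \<in> K"
    using star radial_mem[OF K(1,2) y(2)] unfolding star_body_def by blast
  then have "inverse ?m *\<^sub>R y \<in> K"
    using pos by simp
  moreover have "\<bar>inverse ?m * t\<bar> \<le> 1"
    using pos by (simp add: abs_mult field_simps)
  ultimately show "inverse ?m *\<^sub>R (y + t *\<^sub>R a) \<in> K"
    by (simp add: scale)
  show "b \<le> inverse ?m" if "b *\<^sub>R (y + t *\<^sub>R a) \<in> K" for b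
  proof -
    have 1: "b \<le> radial K y" "\<bar>b * t\<bar> \<le> 1"
      using that le_radial[OF K(1,2) y(2)] by (auto simp: scale)
    have "b * \<bar>t\<bar> \<le> 1"
      using 1(2) abs_ge_self[of b] mult_right_mono[of b "\<bar>b\<bar>" "\<bar>t\<bar>"] by (simp add: abs_mult)
    moreover have "b * inverse (radial K y) \<le> 1"
      using 1(1) pos by (simp add: field_simps)
    ultimately have "b * ?m \<le> 1"
      by (auto simp: max_def)
    then show ?thesis
      using pos by (simp add: field_simps)
  qed
qed

text \<open>By the cylinder formula the first factor is almost everywhere \<open>radial K\<close> at
  \<open>\<tau> *\<^sub>R a + T \<epsilon> w\<close>. At \<open>\<epsilon> = 0\<close> the average
  runs over a translate of \<open>H\<close>, and \<open>J 0 0 - J 0 s\<close> is the limit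
  \<open>D(s)\<close>.\<close>

definition J :: "real \<Rightarrow> real \<Rightarrow> real" where
  "J \<epsilon> \<tau> = (\<integral>w. inverse (max \<bar>\<epsilon> * (w \<bullet> e) + \<tau>\<bar> (q w)) * exp (- (norm w)\<^sup>2) \<partial>lborel)"

lemma P_nonzero:
  assumes "\<forall>b\<in>Basis. w \<bullet> b \<noteq> 0"
  shows "P w \<noteq> 0"
proof -
  have "card (Basis - {e}) \<noteq> 0"
    using dim e by simp
  then have "Basis - {e} \<noteq> {}"
    by (metis card.empty)
  then obtain b where b: "b \<in> Basis" "b \<noteq> e" by auto
  then show ?thesis
    using P_inner[OF b, of w] assms by force
qed

lemma q_pos: "P w \<noteq> 0 \<Longrightarrow> 0 < q w"
  unfolding q_def using norm_fP[of w] by (intro positive_imp_inverse_positive radial_pos) auto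

text \<open>As \<open>K\<close> lies in a ball of radius \<open>R\<close>, \<open>q w\<close> is at
  least \<open>norm (P w) / R\<close>. The power -7/2 of \<open>norm (P w)\<close> is integrable
  near 0 because \<open>DIM('a) \<ge> 5\<close> leaves four coordinates besides \<open>e\<close>.
  The value 7/2 is 1 more than the exponent 5/2 of the doubling argument.\<close>

lemma integrable_q_powr: "integrable lborel (\<lambda>w. q w powr (- 7/2) * exp (- (norm w)\<^sup>2))"
proof -
  obtain R where R: "R > 0" "\<And>x. x \<in> K \<Longrightarrow> norm x \<le> R"
    using compact_imp_bounded[OF K(1)] bounded_pos by metis
  have "card (Basis - {e}) \<ge> 4"
    using dim e by simp
  then obtain B where B: "B \<subseteq> Basis - {e}" "card B = 4"
    using obtain_subset_with_card_n by metis
  have finB: "finite B" using B(2) card.infinite by fastforce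
  \<comment> \<open>\<open>norm (P w)\<close> dominates each of the four coordinates in \<open>B\<close>; sharing the power \<open>-7/2\<close> equally
    among them leaves the exponent \<open>-7/8 > -1\<close>, integrable in each variable.\<close>
  define p where "p b = (if b \<in> B then - 7/8 else 0 :: real)" for b
  have "integrable lborel (\<lambda>w::'a. R powr (7/2) * ((\<Prod>b\<in>Basis. \<bar>w \<bullet> b\<bar> powr p b) * exp (- (norm w)\<^sup>2)))"
    by (intro integrable_mult_right integrable_prod_powr_gauss) (auto simp: p_def)
  then show ?thesis
  proof (rule Bochner_Integration.integrable_bound)
    show "AE w in lborel. norm (q w powr (- 7/2) * exp (- (norm w)\<^sup>2)) \<le>
        norm (R powr (7/2) * ((\<Prod>b\<in>Basis. \<bar>w \<bullet> b\<bar> powr p b) * exp (- (norm w)\<^sup>2)))"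
      using AE_lborel_inner_nonzero
    proof eventually_elim
      fix w :: 'a assume w: "\<forall>b\<in>Basis. w \<bullet> b \<noteq> 0"
      have Pw: "P w \<noteq> 0" by (rule P_nonzero[OF w])
      then have f0: "f (P w) \<noteq> 0" using norm_fP[of w] by auto
      have "radial K (f (P w)) * norm (P w) \<le> R"
        using R(2)[OF radial_mem[OF K(1,2) f0]] radial_pos[OF f0] by (simp add: norm_fP)
      then have "norm (P w) / R \<le> q w"
        using radial_pos[OF f0] R(1) by (simp add: q_def field_simps)
      then have "q w powr (- 7/2) \<le> (norm (P w) / R) powr (- 7/2)"
        using Pw R(1) by (intro powr_mono2') auto
      also have "\<dots> = R powr (7/2) * norm (P w) powr (- 7/2)"
        using R(1) by (simp add: powr_divide powr_minus field_simps)
      also have "norm (P w) powr (- 7/2) = (\<Prod>b\<in>B. norm (P w) powr (- 7/8))"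
        using Pw B(2) by (simp add: powr_power)
      also have "\<dots> \<le> (\<Prod>b\<in>B. \<bar>w \<bullet> b\<bar> powr (- 7/8))"
      proof (intro prod_mono conjI)
        fix b assume "b \<in> B"
        then have b: "b \<in> Basis" "b \<noteq> e" using B by auto
        then have "\<bar>w \<bullet> b\<bar> \<le> norm (P w)"
          using P_inner[OF b, of w] Basis_le_norm[OF b(1), of "P w"] by simp
        then show "norm (P w) powr (- 7/8) \<le> \<bar>w \<bullet> b\<bar> powr (- 7/8)"
          using w b by (intro powr_mono2') auto
      qed auto
      also have "(\<Prod>b\<in>B. \<bar>w \<bullet> b\<bar> powr (- 7/8)) = (\<Prod>b\<in>Basis. \<bar>w \<bullet> b\<bar> powr p b)"
        using B(1) w by (intro prod.mono_neutral_cong_left) (auto simp: p_def)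
      finally have "q w powr (- 7/2) \<le> R powr (7/2) * (\<Prod>b\<in>Basis. \<bar>w \<bullet> b\<bar> powr p b)"
        using R(1) by (simp add: mult_left_mono)
      then have "q w powr (- 7/2) * exp (- (norm w)\<^sup>2) \<le> R powr (7/2) * (\<Prod>b\<in>Basis. \<bar>w \<bullet> b\<bar> powr p b) * exp (- (norm w)\<^sup>2)"
        by (rule mult_right_mono) simp
      then show "norm (q w powr (- 7/2) * exp (- (norm w)\<^sup>2)) \<le>
          norm (R powr (7/2) * ((\<Prod>b\<in>Basis. \<bar>w \<bullet> b\<bar> powr p b) * exp (- (norm w)\<^sup>2)))"
        by (simp add: abs_mult mult.assoc abs_of_nonneg prod_nonneg)
    qed
  qed measurable
qed

text \<open>Small \<open>q w\<close> is controlled by the power -7/2 and large \<open>q w\<close> by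
  the constant 1. The result is a majorant for all integrands of \<open>J\<close>, uniform in both
  parameters.\<close>

lemma integrable_inverse_q: "integrable lborel (\<lambda>w. inverse (q w) * exp (- (norm w)\<^sup>2))"
proof -
  have "integrable lborel (\<lambda>w::'a. (\<Prod>b\<in>Basis. \<bar>w \<bullet> b\<bar> powr 0) * exp (- (norm w)\<^sup>2))"
    by (intro integrable_prod_powr_gauss) simp
  from Bochner_Integration.integrable_add[OF this integrable_q_powr] show ?thesis
  proof (rule Bochner_Integration.integrable_bound)
    show "AE w in lborel. norm (inverse (q w) * exp (- (norm w)\<^sup>2)) \<le>
        norm ((\<Prod>b\<in>Basis. \<bar>w \<bullet> b\<bar> powr 0) * exp (- (norm w)\<^sup>2) + q w powr (- 7/2) * exp (- (norm w)\<^sup>2))"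
      using AE_lborel_inner_nonzero
    proof eventually_elim
      fix w :: 'a assume w: "\<forall>b\<in>Basis. w \<bullet> b \<noteq> 0"
      have q: "0 < q w" by (rule q_pos[OF P_nonzero[OF w]])
      have "inverse (q w) \<le> 1 + q w powr (- 7/2)"
      proof (cases "q w \<ge> 1")
        case True
        then have "inverse (q w) \<le> 1" by (simp add: field_simps)
        then show ?thesis by (simp add: add_increasing2)
      next
        case False
        have "inverse (q w) = q w powr (- 1)" using q by (simp add: powr_minus)
        also have "\<dots> \<le> q w powr (- 7/2)" using False q by (intro powr_mono') auto
        finally show ?thesis by simp
      qed
      then have "inverse (q w) * exp (- (norm w)\<^sup>2) \<le> (1 + q w powr (- 7/2)) * exp (- (norm w)\<^sup>2)"
        by (rule mult_right_mono) simp
      then show "norm (inverse (q w) * exp (- (norm w)\<^sup>2)) \<le>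
          norm ((\<Prod>b\<in>Basis. \<bar>w \<bullet> b\<bar> powr 0) * exp (- (norm w)\<^sup>2) + q w powr (- 7/2) * exp (- (norm w)\<^sup>2))"
        using w q by (simp add: abs_mult distrib_right)
    qed
  qed measurable
qed

lemma norm_J_integrand_le:
  assumes "P w \<noteq> 0"
  shows "norm (inverse (max \<bar>t\<bar> (q w)) * exp (- (norm w)\<^sup>2)) \<le> inverse (q w) * exp (- (norm w)\<^sup>2)"
proof -
  have q: "0 < q w" by (rule q_pos[OF assms])
  then have "inverse (max \<bar>t\<bar> (q w)) \<le> inverse (q w)" "0 \<le> inverse (max \<bar>t\<bar> (q w))"
    by (auto intro: le_imp_inverse_le simp: le_max_iff_disj)
  then show ?thesis
    by (simp add: abs_mult mult_right_mono)
qed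

lemma AE_P_nonzero: "AE w in lborel. P w \<noteq> 0"
  using AE_lborel_inner_nonzero P_nonzero by (rule eventually_mono)

lemma integrable_J: "integrable lborel (\<lambda>w. inverse (max \<bar>\<epsilon> * (w \<bullet> e) + \<tau>\<bar> (q w)) * exp (- (norm w)\<^sup>2))"
proof (rule Bochner_Integration.integrable_bound[OF integrable_inverse_q])
  show "AE w in lborel. norm (inverse (max \<bar>\<epsilon> * (w \<bullet> e) + \<tau>\<bar> (q w)) * exp (- (norm w)\<^sup>2)) \<le>
      norm (inverse (q w) * exp (- (norm w)\<^sup>2))"
    using AE_P_nonzero
  proof eventually_elim
    fix w assume "P w \<noteq> 0"
    from norm_J_integrand_le[OF this] show "norm (inverse (max \<bar>\<epsilon> * (w \<bullet> e) + \<tau>\<bar> (q w)) * exp (- (norm w)\<^sup>2)) \<le>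
        norm (inverse (q w) * exp (- (norm w)\<^sup>2))"
      unfolding real_norm_def by (rule order_trans[OF _ abs_ge_self])
  qed
qed measurable

lemma J_nonneg: "0 \<le> J \<epsilon> \<tau>"
  unfolding J_def
proof (rule integral_nonneg_AE)
  show "AE w in lborel. 0 \<le> inverse (max \<bar>\<epsilon> * (w \<bullet> e) + \<tau>\<bar> (q w)) * exp (- (norm w)\<^sup>2)"
    by (intro AE_I2 mult_nonneg_nonneg) (auto simp: le_max_iff_disj)
qed

text \<open>The majorant \<open>inverse (q w)\<close> does not depend on \<open>\<epsilon>\<close>,
  and positivity of \<open>q w\<close> keeps the limiting denominator nonzero.\<close>

lemma J_tendsto: "(\<lambda>m. J (inverse (real (Suc m))) \<tau>) \<longlonglongrightarrow> J 0 \<tau>"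
  unfolding J_def
proof (rule integral_dominated_convergence[OF _ _ integrable_inverse_q])
  show "AE w in lborel. (\<lambda>m. inverse (max \<bar>inverse (real (Suc m)) * (w \<bullet> e) + \<tau>\<bar> (q w)) * exp (- (norm w)\<^sup>2))
      \<longlonglongrightarrow> inverse (max \<bar>0 * (w \<bullet> e) + \<tau>\<bar> (q w)) * exp (- (norm w)\<^sup>2)"
    using AE_P_nonzero
  proof eventually_elim
    fix w assume "P w \<noteq> 0"
    then have "max \<bar>0 * (w \<bullet> e) + \<tau>\<bar> (q w) \<noteq> 0"
      using q_pos[of w] by (auto simp: max_def)
    then show "(\<lambda>m. inverse (max \<bar>inverse (real (Suc m)) * (w \<bullet> e) + \<tau>\<bar> (q w)) * exp (- (norm w)\<^sup>2))
      \<longlonglongrightarrow> inverse (max \<bar>0 * (w \<bullet> e) + \<tau>\<bar> (q w)) * exp (- (norm w)\<^sup>2)"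
      by (intro tendsto_intros LIMSEQ_inverse_real_of_nat)
  qed
  show "AE w in lborel. norm (inverse (max \<bar>inverse (real (Suc m)) * (w \<bullet> e) + \<tau>\<bar> (q w)) * exp (- (norm w)\<^sup>2))
      \<le> inverse (q w) * exp (- (norm w)\<^sup>2)" for m
    using AE_P_nonzero by eventually_elim (rule norm_J_integrand_le)
qed measurable

text \<open>Substituting \<open>x = \<tau> *\<^sub>R a + T \<epsilon> w\<close>, with
  \<open>M\<close> inverse to \<open>T \<epsilon>\<close>, makes the shifted Gaussian standard. The
  factors \<open>c1\<close> and \<open>c2\<close> do not depend on \<open>\<tau>\<close>, so the
  three-term inequality carries over to \<open>J\<close>.\<close>

lemma J_inequality_eps:
  assumes K: "intersection_body K" and \<epsilon>: "\<epsilon> \<noteq> 0"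
  shows "0 \<le> 3 * J \<epsilon> 0 - 4 * J \<epsilon> s + J \<epsilon> (2 * s)"
proof -
  obtain M where M: "linear M" and MT: "\<And>w. M (T \<epsilon> w) = w" and TM: "\<And>x. T \<epsilon> (M x) = x"
    using linear_injective_isomorphism[OF linear_T inj_T[OF \<epsilon>]] by metis
  have injM: "inj M"
    using TM by (rule inj_on_inverseI)
  have k: "DIM('a) = Suc (Suc (DIM('a) - 2))"
    using dim by simp
  obtain I where I: "\<And>u. 0 \<le> I u" "0 \<le> 3 * I 0 - 4 * I (s *\<^sub>R a) + I (2 *\<^sub>R (s *\<^sub>R a))"
    "\<And>u. ennreal (I u) = (\<integral>\<^sup>+x. ennreal (radial K x * gauss M u x) \<partial>subspace_lborel UNIV)"
    by (rule intersection_body_gauss_inequality[OF K k M injM, of "s *\<^sub>R a"]) blast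
  obtain c1 where c1: "0 < c1" "\<And>h :: 'a \<Rightarrow> ennreal. h \<in> borel_measurable borel \<Longrightarrow>
      (\<integral>\<^sup>+x. h x \<partial>subspace_lborel UNIV) = ennreal c1 * (\<integral>\<^sup>+x. h x \<partial>lborel)"
    using nn_integral_subspace_lborel_UNIV by blast
  obtain c2 where c2: "0 < c2" "\<And>h. h \<in> borel_measurable borel \<Longrightarrow>
      (\<integral>\<^sup>+x. h (T \<epsilon> x) \<partial>lborel) = ennreal c2 * (\<integral>\<^sup>+x. h x \<partial>lborel)"
    using nn_integral_lborel_linear[OF linear_T inj_T[OF \<epsilon>]] by blast
  note [measurable] = borel_measurable_gauss[OF M] borel_measurable_radial[OF star]
  have eq: "c2 * I (\<tau> *\<^sub>R a) = c1 * J \<epsilon> \<tau>" for \<tau>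
  proof -
    let ?h = "\<lambda>x. ennreal (radial K x * gauss M (\<tau> *\<^sub>R a) x)"
    have "ennreal (J \<epsilon> \<tau>) = (\<integral>\<^sup>+w. ennreal (inverse (max \<bar>\<epsilon> * (w \<bullet> e) + \<tau>\<bar> (q w)) * exp (- (norm w)\<^sup>2)) \<partial>lborel)"
      unfolding J_def by (intro nn_integral_eq_integral[symmetric] integrable_J AE_I2 mult_nonneg_nonneg)
        (auto simp: le_max_iff_disj)
    also have "\<dots> = (\<integral>\<^sup>+w. ?h (\<tau> *\<^sub>R a + T \<epsilon> w) \<partial>lborel)"
      using AE_P_nonzero
    proof (intro nn_integral_cong_AE, eventually_elim)
      fix w assume "P w \<noteq> 0"
      then have "f (P w) \<noteq> 0" using norm_fP[of w] by auto
      moreover have "f (P w) \<in> H" by (intro f_mem) simp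
      moreover have "\<tau> *\<^sub>R a + T \<epsilon> w = f (P w) + (\<epsilon> * (w \<bullet> e) + \<tau>) *\<^sub>R a"
        by (simp add: T_def algebra_simps)
      ultimately have "radial K (\<tau> *\<^sub>R a + T \<epsilon> w) = inverse (max \<bar>\<epsilon> * (w \<bullet> e) + \<tau>\<bar> (q w))"
        by (simp add: radial_cylinder q_def)
      then show "ennreal (inverse (max \<bar>\<epsilon> * (w \<bullet> e) + \<tau>\<bar> (q w)) * exp (- (norm w)\<^sup>2)) = ?h (\<tau> *\<^sub>R a + T \<epsilon> w)"
        by (simp add: gauss_def MT)
    qed
    also have "\<dots> = ennreal c2 * (\<integral>\<^sup>+x. ?h (\<tau> *\<^sub>R a + x) \<partial>lborel)"
      by (rule c2(2)) measurable
    also have "(\<integral>\<^sup>+x. ?h (\<tau> *\<^sub>R a + x) \<partial>lborel) = (\<integral>\<^sup>+x. ?h x \<partial>distr lborel borel ((+) (\<tau> *\<^sub>R a)))"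
      by (subst nn_integral_distr) auto
    finally have J: "ennreal (J \<epsilon> \<tau>) = ennreal c2 * (\<integral>\<^sup>+x. ?h x \<partial>lborel)"
      by (simp only: lborel_distr_plus)
    have "ennreal (c2 * I (\<tau> *\<^sub>R a)) = ennreal c2 * (ennreal c1 * (\<integral>\<^sup>+x. ?h x \<partial>lborel))"
      using c2(1) I(1,3) c1(2)[of ?h] by (simp add: ennreal_mult)
    also have "\<dots> = ennreal (c1 * J \<epsilon> \<tau>)"
      using c1(1) J_nonneg[of \<epsilon> \<tau>] J by (simp add: ennreal_mult mult.left_commute)
    finally show ?thesis
      using c1(1) c2(1) I(1)[of "\<tau> *\<^sub>R a"] J_nonneg[of \<epsilon> \<tau>] by simp
  qed
  have "0 \<le> c2 * (3 * I 0 - 4 * I (s *\<^sub>R a) + I (2 *\<^sub>R (s *\<^sub>R a)))"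
    using c2(1) I(2) by simp
  also have "\<dots> = c1 * (3 * J \<epsilon> 0 - 4 * J \<epsilon> s + J \<epsilon> (2 * s))"
    using eq[of 0] eq[of s] eq[of "2 * s"] by (simp add: algebra_simps)
  finally show ?thesis
    using c1(1) by (simp add: zero_le_mult_iff)
qed

text \<open>Since \<open>T 0\<close> is not injective, the degenerate case is reached only as a
  limit, here along \<open>inverse (real (Suc m))\<close>.\<close>

lemma J_inequality:
  assumes "intersection_body K"
  shows "0 \<le> 3 * J 0 0 - 4 * J 0 s + J 0 (2 * s)"
proof (rule LIMSEQ_le_const)
  show "(\<lambda>m. 3 * J (inverse (real (Suc m))) 0 - 4 * J (inverse (real (Suc m))) s + J (inverse (real (Suc m))) (2 * s))
      \<longlonglongrightarrow> 3 * J 0 0 - 4 * J 0 s + J 0 (2 * s)"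
    by (intro tendsto_intros J_tendsto)
  show "\<exists>N. \<forall>m\<ge>N. 0 \<le> 3 * J (inverse (real (Suc m))) 0 - 4 * J (inverse (real (Suc m))) s + J (inverse (real (Suc m))) (2 * s)"
    using J_inequality_eps[OF assms] by simp
qed

lemma J_diff: "J 0 0 - J 0 s = (\<integral>w. (inverse (max 0 (q w)) - inverse (max \<bar>s\<bar> (q w))) * exp (- (norm w)\<^sup>2) \<partial>lborel)"
  unfolding J_def
  by (subst Bochner_Integration.integral_diff[symmetric, OF integrable_J integrable_J]) (simp add: left_diff_distrib)

text \<open>The difference vanishes for \<open>s \<le> q w\<close>. Otherwise it is at most
  \<open>inverse (q w)\<close>, which is \<open>q w powr (5/2) * q w powr (- 7/2)\<close>, and the
  first factor is below \<open>s powr (5/2)\<close>. The third claim is what yields the final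
  contradiction.\<close>

lemma integrand_diff_bounds:
  assumes "0 < s" "P w \<noteq> 0"
  shows "0 \<le> inverse (max 0 (q w)) - inverse (max \<bar>s\<bar> (q w))"
    and "inverse (max 0 (q w)) - inverse (max \<bar>s\<bar> (q w)) \<le> s powr (5/2) * q w powr (- 7/2)"
    and "inverse (max 0 (q w)) - inverse (max \<bar>s\<bar> (q w)) = 0 \<Longrightarrow> s \<le> q w"
proof -
  have q: "0 < q w" by (rule q_pos[OF assms(2)])
  show "0 \<le> inverse (max 0 (q w)) - inverse (max \<bar>s\<bar> (q w))"
    using q assms(1) by (auto simp: max_def le_imp_inverse_le)
  show "s \<le> q w" if "inverse (max 0 (q w)) - inverse (max \<bar>s\<bar> (q w)) = 0"
    using that q assms(1) by (auto simp: max_def split: if_splits)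
  show "inverse (max 0 (q w)) - inverse (max \<bar>s\<bar> (q w)) \<le> s powr (5/2) * q w powr (- 7/2)"
  proof (cases "s \<le> q w")
    case False
    have "inverse (max 0 (q w)) - inverse (max \<bar>s\<bar> (q w)) \<le> inverse (q w)"
      using q assms(1) False by (simp add: max_def)
    also have "\<dots> = q w powr (5/2) * q w powr (- 7/2)"
      unfolding powr_add[symmetric] using q by (simp add: powr_minus)
    also have "\<dots> \<le> s powr (5/2) * q w powr (- 7/2)"
      using q False by (intro mult_right_mono powr_mono2) auto
    finally show ?thesis .
  qed (use q assms(1) in \<open>simp add: max_def\<close>)
qed

lemma not_intersection_body: "\<not> intersection_body K"
proof
  assume K: "intersection_body K"
  let ?F = "\<lambda>s w. (inverse (max 0 (q w)) - inverse (max \<bar>s\<bar> (q w))) * exp (- (norm w)\<^sup>2)"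
  have int: "integrable lborel (?F s)" for s
    using Bochner_Integration.integrable_diff[OF integrable_J[of 0 0] integrable_J[of 0 s]]
    by (simp add: left_diff_distrib)
  \<comment> \<open>The constant \<open>C\<close> of the doubling argument is the integral of
    \<open>integrable_q_powr\<close>.\<close>
  have zero: "J 0 0 - J 0 s = 0" if "0 < s" for s
  proof (rule doubling_eq_zero[where H = "\<lambda>s. J 0 0 - J 0 s", OF _ _ _ that])
    fix s :: real assume s: "0 < s"
    show "J 0 0 - J 0 (2 * s) \<le> 4 * (J 0 0 - J 0 s)"
      using J_inequality[OF K, of s] by simp
    show "0 \<le> J 0 0 - J 0 s"
      unfolding J_diff
      by (rule integral_nonneg_AE, rule eventually_mono[OF AE_P_nonzero])
        (intro mult_nonneg_nonneg integrand_diff_bounds(1)[OF s], auto)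
    show "J 0 0 - J 0 s \<le> (\<integral>w. q w powr (- 7/2) * exp (- (norm w)\<^sup>2) \<partial>lborel) * s powr (5/2)"
      unfolding J_diff
    proof (subst integral_mult_left_zero[symmetric], rule integral_mono_AE[OF int])
      show "integrable lborel (\<lambda>w. q w powr (- 7/2) * exp (- (norm w)\<^sup>2) * s powr (5/2))"
        by (intro integrable_mult_left integrable_q_powr)
      show "AE w in lborel. ?F s w \<le> q w powr (- 7/2) * exp (- (norm w)\<^sup>2) * s powr (5/2)"
        using AE_P_nonzero
      proof eventually_elim
        fix w assume "P w \<noteq> 0"
        from mult_right_mono[OF integrand_diff_bounds(2)[OF s this], of "exp (- (norm w)\<^sup>2)"]
        show "?F s w \<le> q w powr (- 7/2) * exp (- (norm w)\<^sup>2) * s powr (5/2)"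
          by (simp add: ac_simps)
      qed
    qed
  qed
  \<comment> \<open>A nonnegative integrand with zero integral vanishes almost everywhere, so the
    gauge exceeds every natural number almost everywhere, although its values are real.\<close>
  have "AE w in lborel. real (Suc n) \<le> q w" for n
  proof -
    have s: "0 < real (Suc n)" by simp
    have nonneg: "AE w in lborel. 0 \<le> ?F (real (Suc n)) w"
      by (rule eventually_mono[OF AE_P_nonzero])
        (intro mult_nonneg_nonneg integrand_diff_bounds(1)[OF s], auto)
    have "integral\<^sup>L lborel (?F (real (Suc n))) = 0"
      using zero[OF s] unfolding J_diff .
    then have "AE w in lborel. ?F (real (Suc n)) w = 0"
      by (subst (asm) integral_nonneg_eq_0_iff_AE[OF int nonneg])
    with AE_P_nonzero show ?thesis
    proof eventually_elim
      fix w assume "P w \<noteq> 0" "?F (real (Suc n)) w = 0"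
      then show "real (Suc n) \<le> q w"
        by (intro integrand_diff_bounds(3)[OF s]) simp_all
    qed
  qed
  then have "AE w in lborel. \<forall>n. real (Suc n) \<le> q w"
    by (simp add: AE_all_countable)
  then have "AE w in (lborel :: 'a measure). False"
  proof eventually_elim
    fix w assume w: "\<forall>n. real (Suc n) \<le> q w"
    obtain n where "q w < real n" using reals_Archimedean2 by blast
    with w[rule_format, of n] show False by simp
  qed
  \<comment> \<open>Lebesgue measure is not the zero measure, so \<open>False\<close> cannot hold
    almost everywhere.\<close>
  then show False
    by (simp add: eventually_False ae_filter_eq_bot_iff)
qed

end

theorem theorem2:
  fixes K :: "(real ^ 'n) set"
  assumes "CARD('n) \<ge> 5"
    and "convex_body K"
    and "origin_symmetric K"
    and "\<exists>A B. segment_body_direct_sum K A B"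
  shows "\<not> intersection_body K"
proof -
  have "K \<noteq> {}"
    using assms(2) interior_subset by (fastforce simp: convex_body_def)
  then obtain a H where H: "subspace H" "dim H = DIM(real ^ 'n) - 1" "a \<notin> H"
    "\<And>y t. y \<in> H \<Longrightarrow> y + t *\<^sub>R a \<in> K \<longleftrightarrow> y \<in> K \<and> \<bar>t\<bar> \<le> 1"
    using segment_body_direct_sum_symmetric assms(3,4) by metis
  obtain e :: "real ^ 'n" where e: "e \<in> Basis"
    using nonempty_Basis by blast
  have dimS: "dim {w. e \<bullet> w = 0} = dim H"
    using e H(2) by (subst dim_hyperplane) auto
  \<comment> \<open>The isometry lets Gaussian integrals over \<open>H\<close> be computed in the
    coordinates orthogonal to the basis vector \<open>e\<close>.\<close>
  obtain f where f: "linear f" "f ` {w. e \<bullet> w = 0} = H" "\<And>w. w \<in> {w. e \<bullet> w = 0} \<Longrightarrow> norm (f w) = norm w"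
    using isometry_subspaces[OF subspace_hyperplane H(1) dimS] by metis
  interpret symmetric_cylinder K H a e f
  proof (rule symmetric_cylinder.intro)
    show "star_body K"
      by (rule symmetric_convex_body_imp_star_body[OF assms(2,3)])
  qed (use H e f assms(1) in \<open>auto simp: inner_commute\<close>)
  show ?thesis
    by (rule not_intersection_body)
qed

end
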